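(* Let $\mathcal{T}$ be a good set of weighted trees. Then the $W$-polynomial distinguishes non-isomorphic members of $\mathcal{T}$: for all $(T,w),(T',w')\in\mathcal{T}$, if $W_{(T,w)}=W_{(T',w')}$, then $(T,w)$ and $(T',w')$ are isomorphic as weighted trees.
   Context: All graphs are finite. A weighted graph is a graph $G=(V,E)$ together with a function $w\colon V\to\mathbf{Z}^+$ (positive integers). A weighted tree is a weighted graph whose underlying graph is a tree. For $V'\subseteq V$, $w(V')=\sum_{v\in V'}w(v)$; for a subtree $S$ write $w(S)=w(V(S))$. $W$-polynomial: for $A\subseteq E$ let $c(A)$ be the number of connected components of the spanning subgraph $(V,A)$, let $n_1\ge\dots\ge n_{c(A)}$ be the weights of the vertex sets of these components, and let $x(A)=\prod_{i=1}^{c(A)}x_{n_i}$, where $x_1,x_2,\dots$ are indeterminates. Then $$W_G(z,x_1,x_2,\dots)=\sum_{A\subseteq E}x(A)(z-1)^{|A|-|V|+c(A)}.$$ (For a tree the exponent of $z-1$ is always $0$.) Two weighted graphs are isomorphic if there is a graph isomorphism between them preserving vertex weights. Two rooted weighted trees are r-isomorphic if there is a graph isomorphism between them preserving the vertex weights and mapping root to root. For a weighted tree $(T,w)$, $\mathrm{Ex}(T)$ denotes the multiset of all vertex weights of $T$ (with multiplicities). A shape of $(T,w)$ is a rooted weighted tree $(S,w_S)$ such that $2\le |V(S)|\le |V(T)|-2$ and there is an edge $e\in E(T)$ such that $S$ is one of the two components of $T-e$; $S$ is rooted at the end-vertex of $e$ that it contains, and $w_S$ is the restriction of $w$ to $V(S)$.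 A leaf is a vertex of degree one. A set $\mathcal{T}$ of weighted trees is good if it satisfies the following. (1) For every $(T,w)\in\mathcal{T}$: if a vertex of $T$ is adjacent to a leaf, then all its neighbours but possibly one are leaves. (2) For every $(T,w)\in\mathcal{T}$: if a vertex $v$ of $T$ is a leaf or has a neighbour that is a leaf, then $w(v)=1$. (3) For all $(T,w),(T',w')\in\mathcal{T}$: if $S$ is a shape of $T$ with $w(S)\le w(T)/2$ and $S'$ is a shape of $T'$ with $\mathrm{Ex}(S')=\mathrm{Ex}(S)$, then $S'$ and $S$ are r-isomorphic. *)

theory Defs
  imports Complex_Main "HOL-Library.Multiset" "HOL-Library.Poly_Mapping"
begin

text \<open>
  The weight function of a graph is total for technical reasons only: every notion below consults
  it solely on the vertices of the graph, so a subgraph may keep the weight function of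
  the graph it lives in, which then plays the role of the restricted weight function.
\<close>

record 'a wgraph =
  verts :: "'a set"
  edges :: "'a set set"
  weight :: "'a \<Rightarrow> nat"

definition weighted_graph :: "'a wgraph \<Rightarrow> bool" where
  "weighted_graph G \<longleftrightarrow>
     finite (verts G) \<and>
     (\<forall>e\<in>edges G. e \<subseteq> verts G \<and> card e = 2) \<and>
     (\<forall>v\<in>verts G. weight G v > 0)"

definition reach :: "'a set \<Rightarrow> 'a set set \<Rightarrow> ('a \<times> 'a) set" where
  "reach V A = {(u, v). u \<in> V \<and> v \<in> V \<and> (u, v) \<in> {(a, b). {a, b} \<in> A}\<^sup>*}"

text \<open>The vertex sets of the connected components of the graph \<open>(V, A)\<close>.\<close>

definition component_sets :: "'a set \<Rightarrow> 'a set set \<Rightarrow> 'a set set" where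
  "component_sets V A = V // reach V A"

definition connected_graph :: "'a wgraph \<Rightarrow> bool" where
  "connected_graph G \<longleftrightarrow>
     verts G \<noteq> {} \<and> (\<forall>u\<in>verts G. \<forall>v\<in>verts G. (u, v) \<in> reach (verts G) (edges G))"

definition is_cycle :: "'a wgraph \<Rightarrow> 'a list \<Rightarrow> bool" where
  "is_cycle G p \<longleftrightarrow>
     length p \<ge> 3 \<and> distinct p \<and>
     (\<forall>i<length p. {p ! i, p ! (Suc i mod length p)} \<in> edges G)"

definition weighted_tree :: "'a wgraph \<Rightarrow> bool" where
  "weighted_tree G \<longleftrightarrow> weighted_graph G \<and> connected_graph G \<and> \<not> (\<exists>p. is_cycle G p)"

definition total_weight :: "'a wgraph \<Rightarrow> nat" where
  "total_weight G = sum (weight G) (verts G)"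


text \<open>
  Polynomials with integer coefficients in the indeterminates \<open>z, x\<^sub>1, x\<^sub>2, \<dots>\<close>: a monomial is a
  finitely supported map from indeterminates to exponents.
\<close>

datatype indet = Zvar | Xvar nat

type_synonym wpoly = "(indet \<Rightarrow>\<^sub>0 nat) \<Rightarrow>\<^sub>0 int"

definition var :: "indet \<Rightarrow> wpoly" where
  "var i = Poly_Mapping.single (Poly_Mapping.single i 1) 1"

definition x_mon :: "'a wgraph \<Rightarrow> 'a set set \<Rightarrow> wpoly" where
  "x_mon G A = (\<Prod>C\<in>component_sets (verts G) A. var (Xvar (sum (weight G) C)))"

text \<open>
  The exponent is \<open>|A| - |V| + c(A)\<close>, reordered so that the subtraction on \<^typ>\<open>nat\<close> does not truncate
  (a graph \<open>(V, A)\<close> has at least \<open>|V| - |A|\<close> components).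
\<close>

definition W_poly :: "'a wgraph \<Rightarrow> wpoly" where
  "W_poly G =
     (\<Sum>A\<in>Pow (edges G).
        x_mon G A *
        (var Zvar - 1) ^ (card A + card (component_sets (verts G) A) - card (verts G)))"


definition graph_iso :: "('a \<Rightarrow> 'b) \<Rightarrow> 'a wgraph \<Rightarrow> 'b wgraph \<Rightarrow> bool" where
  "graph_iso f G H \<longleftrightarrow>
     bij_betw f (verts G) (verts H) \<and>
     (\<forall>u\<in>verts G. \<forall>v\<in>verts G. {u, v} \<in> edges G \<longleftrightarrow> {f u, f v} \<in> edges H) \<and>
     (\<forall>v\<in>verts G. weight H (f v) = weight G v)"

definition isomorphic :: "'a wgraph \<Rightarrow> 'b wgraph \<Rightarrow> bool" where
  "isomorphic G H \<longleftrightarrow> (\<exists>f. graph_iso f G H)"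

type_synonym 'a rooted_wgraph = "'a wgraph \<times> 'a"

definition r_isomorphic :: "'a rooted_wgraph \<Rightarrow> 'b rooted_wgraph \<Rightarrow> bool" where
  "r_isomorphic S R \<longleftrightarrow> (\<exists>f. graph_iso f (fst S) (fst R) \<and> f (snd S) = snd R)"


definition Ex_weights :: "'a wgraph \<Rightarrow> nat multiset" where
  "Ex_weights G = image_mset (weight G) (mset_set (verts G))"

definition neighbours :: "'a wgraph \<Rightarrow> 'a \<Rightarrow> 'a set" where
  "neighbours G v = {u \<in> verts G. {u, v} \<in> edges G}"

definition is_leaf :: "'a wgraph \<Rightarrow> 'a \<Rightarrow> bool" where
  "is_leaf G v \<longleftrightarrow> v \<in> verts G \<and> card (neighbours G v) = 1"

definition delete_edge :: "'a wgraph \<Rightarrow> 'a set \<Rightarrow> 'a wgraph" where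
  "delete_edge G e = G\<lparr>edges := edges G - {e}\<rparr>"

definition induced :: "'a wgraph \<Rightarrow> 'a set \<Rightarrow> 'a wgraph" where
  "induced G C = G\<lparr>verts := C, edges := {e \<in> edges G. e \<subseteq> C}\<rparr>"

definition components :: "'a wgraph \<Rightarrow> 'a wgraph set" where
  "components G = induced G ` component_sets (verts G) (edges G)"

text \<open>The bound \<open>|V(S)| \<le> |V(T)| - 2\<close> is written without subtraction on \<^typ>\<open>nat\<close>.\<close>

definition is_shape :: "'a wgraph \<Rightarrow> 'a rooted_wgraph \<Rightarrow> bool" where
  "is_shape T S \<longleftrightarrow>
     2 \<le> card (verts (fst S)) \<and> card (verts (fst S)) + 2 \<le> card (verts T) \<and>
     (\<exists>e\<in>edges T. fst S \<in> components (delete_edge T e) \<and> snd S \<in> e \<inter> verts (fst S))"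

definition good :: "'a wgraph set \<Rightarrow> bool" where
  "good \<T> \<longleftrightarrow>
     (\<forall>T\<in>\<T>. weighted_tree T) \<and>
     (\<forall>T\<in>\<T>. \<forall>v\<in>verts T. (\<exists>u\<in>neighbours T v. is_leaf T u) \<longrightarrow>
        card {u \<in> neighbours T v. \<not> is_leaf T u} \<le> 1) \<and>
     (\<forall>T\<in>\<T>. \<forall>v\<in>verts T. is_leaf T v \<or> (\<exists>u\<in>neighbours T v. is_leaf T u) \<longrightarrow>
        weight T v = 1) \<and>
     (\<forall>T\<in>\<T>. \<forall>T'\<in>\<T>. \<forall>S S'.
        is_shape T S \<and> real (total_weight (fst S)) \<le> real (total_weight T) / 2 \<and>
        is_shape T' S' \<and> Ex_weights (fst S') = Ex_weights (fst S) \<longrightarrow>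
        r_isomorphic S' S)"

end

theory Submission
  imports Defs
begin

text \<open>
  Deleting an edge of a tree leaves two branches. Call a branch light if it carries at most half of
  the total weight \<open>N\<close>; the light branches form a laminar family. For a tree, the polynomial records,
  for every multiset \<open>P\<close>, how many edge sets leave components of weights \<open>P\<close>. If \<open>P\<close> consists
  of a part of size at least \<open>N/2\<close> and a multiset \<open>M\<close>, then orienting the removed edges away from
  the big component turns this number into the number of families \<open>\<U>\<close> of light branches
  whose parts \<open>S - \<Union>{R \<in> \<U>. R \<subset> S}\<close> have weights \<open>M\<close>.

  Such a family either consists of branches that are lighter than \<open>M\<close>, or as heavy but
  with more vertices than \<open>M\<close> has elements, or it cuts one branch with vertex weights \<open>M\<close> into
  single vertices. Branches of two good trees with equal vertex weights are r-isomorphic, so by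
  induction (on weight, then downwards on the number of vertices) the smaller branches of
  the two trees form isomorphic weighted posets and contribute equally. Hence the trees have equally
  many light branches with vertex weights \<open>M\<close>, and their posets of light branches are isomorphic.

  This poset determines the tree. Choosing one light branch per edge, the parts are
  single vertices, the edges are the covering pairs, and one more vertex lies outside all branches.
\<close>

section \<open>Connected components\<close>

text \<open>A coefficient tells the component weights but not which components are adjacent. A
  component of weight at least \<open>N/2\<close> serves as a root: every removed edge has a side
  away from it, and that side is light. The same bound yields laminarity, since two overlapping
  light sets are too light to cover all vertices. When the big weight occurs several times, the
  number of choices of the root component depends only on the multiset, so it is the same for both
  trees.

  Counting alone would be circular: the number of families with given part weights depends on how
  the branches are nested, while the nesting is what is sought. Goodness breaks the circle, because
  the vertex weights of a light branch fix everything below it; equal numbers of branches for every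
  multiset then suffice to match the two posets.

  The order of the induction comes from one estimate. If a branch of the family has the full weight
  of \<open>M\<close>, it is the union of the family and is divided into \<open>size M\<close>
  nonempty parts, so it has at least \<open>size M\<close> vertices, with equality exactly when all
  parts are single vertices.\<close>

lemma rtrancl_distinct_path:
  assumes "(u, v) \<in> R\<^sup>*"
  shows "\<exists>p. p \<noteq> [] \<and> hd p = u \<and> last p = v \<and> distinct p \<and> successively (\<lambda>x y. (x, y) \<in> R) p"
  using assms
proof (induction rule: rtrancl_induct)
  case base
  show ?case by (rule exI[of _ "[u]"]) simp
next
  case (step y z)
  then obtain p where p: "p \<noteq> []" "hd p = u" "last p = y" "distinct p"
    "successively (\<lambda>x y. (x, y) \<in> R) p" by blast
  show ?case
  proof (cases "z \<in> set p")
    case True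
    then obtain q r where q: "p = q @ z # r" by (meson split_list)
    have "successively (\<lambda>x y. (x, y) \<in> R) (q @ [z])"
      using p(5) unfolding q by (auto simp: successively_append_iff)
    moreover have "hd (q @ [z]) = u" using p(2) q by (cases q) auto
    ultimately show ?thesis using p(4) q by (intro exI[of _ "q @ [z]"]) auto
  next
    case False
    then show ?thesis using p step(2)
      by (intro exI[of _ "p @ [z]"]) (auto simp: successively_append_iff)
  qed
qed

lemma reach_equiv: "equiv V (reach V A)"
proof (rule equivI)
  show "reach V A \<subseteq> V \<times> V" by (auto simp: reach_def)
  show "refl_on V (reach V A)" by (auto simp: refl_on_def reach_def)
  have "sym {(a, b). {a, b} \<in> A}" by (auto simp: sym_def insert_commute)
  then have "sym ({(a, b). {a, b} \<in> A}\<^sup>*)" by (rule sym_rtrancl)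
  then show "sym (reach V A)" unfolding sym_def reach_def by blast
  show "trans (reach V A)" unfolding trans_def reach_def by auto
qed

lemma reach_sym: "(u, v) \<in> reach V A \<Longrightarrow> (v, u) \<in> reach V A"
  using reach_equiv[of V A] by (meson equiv_def symD)

lemma reach_trans: "(u, v) \<in> reach V A \<Longrightarrow> (v, x) \<in> reach V A \<Longrightarrow> (u, x) \<in> reach V A"
  using reach_equiv[of V A] by (meson equiv_def transD)

lemma reach_edge: "u \<in> V \<Longrightarrow> v \<in> V \<Longrightarrow> {u, v} \<in> A \<Longrightarrow> (u, v) \<in> reach V A"
  by (auto simp: reach_def)

lemma reach_mono: "A \<subseteq> B \<Longrightarrow> reach V A \<subseteq> reach V B"
proof -
  assume "A \<subseteq> B"
  then have "{(a, b). {a, b} \<in> A}\<^sup>* \<subseteq> {(a, b). {a, b} \<in> B}\<^sup>*" by (intro rtrancl_mono) auto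
  then show ?thesis by (auto simp: reach_def)
qed

lemma reach_closed:
  assumes "(u, v) \<in> reach V A" "u \<in> C"
    and "\<And>x y. {x, y} \<in> A \<Longrightarrow> x \<in> C \<Longrightarrow> y \<in> C"
  shows "v \<in> C"
proof -
  have "(u, v) \<in> {(a, b). {a, b} \<in> A}\<^sup>*" using assms(1) by (auto simp: reach_def)
  then show ?thesis
    by (induction rule: rtrancl_induct) (use assms(2,3) in auto)
qed

lemma component_sets_Union: "\<Union> (component_sets V A) = V"
  unfolding component_sets_def by (rule Union_quotient[OF reach_equiv])

lemma component_sets_disjoint:
  "C \<in> component_sets V A \<Longrightarrow> D \<in> component_sets V A \<Longrightarrow> C = D \<or> C \<inter> D = {}"
  unfolding component_sets_def by (rule quotient_disj[OF reach_equiv])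

lemma component_sets_nonempty: "C \<in> component_sets V A \<Longrightarrow> C \<noteq> {}"
  unfolding component_sets_def using in_quotient_imp_non_empty[OF reach_equiv] by metis

lemma component_sets_subset: "C \<in> component_sets V A \<Longrightarrow> C \<subseteq> V"
  using component_sets_Union by fastforce

lemma finite_component_sets: "finite V \<Longrightarrow> finite (component_sets V A)"
  by (rule finite_subset[of _ "Pow V"]) (auto dest: component_sets_subset)

lemma component_sets_edge:
  assumes "C \<in> component_sets V A" "{x, y} \<in> A" "x \<in> C" "y \<in> V"
  shows "y \<in> C"
proof -
  have "(x, y) \<in> reach V A" using assms component_sets_subset by (blast intro: reach_edge)
  then show ?thesis using assms(1,3) in_quotient_imp_closed[OF reach_equiv]
    unfolding component_sets_def by metis
qed

text \<open>A partition that is coarser than the components but has at least as many blocks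
  consists of the components.\<close>

lemma component_sets_eqI:
  assumes "finite V"
    and P: "\<Union>P = V" "{} \<notin> P" "\<And>C D. C \<in> P \<Longrightarrow> D \<in> P \<Longrightarrow> C = D \<or> C \<inter> D = {}"
    and closed: "\<And>C x y. C \<in> P \<Longrightarrow> {x, y} \<in> A \<Longrightarrow> x \<in> C \<Longrightarrow> y \<in> C"
    and card: "card (component_sets V A) \<le> card P"
  shows "component_sets V A = P"
proof -
  let ?Q = "component_sets V A"
  have finP: "finite P" using assms(1) P(1) by (metis finite_UnionD)
  have sub: "C \<subseteq> D" if C: "C \<in> ?Q" and D: "D \<in> P" and ne: "C \<inter> D \<noteq> {}" for C D
  proof
    fix y assume y: "y \<in> C"
    from ne obtain x where x: "x \<in> C" "x \<in> D" by blast
    have "(x, y) \<in> reach V A"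
      using C x y in_quotient_imp_in_rel[OF reach_equiv, of C V A x y]
      unfolding component_sets_def by blast
    then show "y \<in> D" using x(2) closed[OF D] by (rule reach_closed)
  qed
  have "\<exists>C\<in>?Q. C \<subseteq> D" if D: "D \<in> P" for D
  proof -
    obtain x where x: "x \<in> D" using D P(2) by (cases "D = {}") auto
    then have "x \<in> \<Union>?Q" using D P(1) component_sets_Union[of V A] by blast
    then show ?thesis using sub D x by blast
  qed
  \<comment> \<open>One component chosen inside each block: disjointness of the blocks makes the
    choice injective, and the cardinality bound then makes it surjective.\<close>
  then obtain g where g: "\<And>D. D \<in> P \<Longrightarrow> g D \<in> ?Q \<and> g D \<subseteq> D" by metis
  have inj: "inj_on g P"
  proof
    fix C D assume "C \<in> P" "D \<in> P" "g C = g D"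
    then have "g C \<subseteq> C \<inter> D" "g C \<noteq> {}" using g component_sets_nonempty by blast+
    then show "C = D" using P(3) \<open>C \<in> P\<close> \<open>D \<in> P\<close> by blast
  qed
  have im: "g ` P = ?Q"
    using card g inj by (intro card_seteq finite_component_sets assms) (auto simp: card_image)
  have "g D = D" if D: "D \<in> P" for D
  proof
    show "D \<subseteq> g D"
    proof
      fix x assume x: "x \<in> D"
      then have "x \<in> \<Union>?Q" using D P(1) component_sets_Union[of V A] by blast
      then obtain D' where D': "D' \<in> P" "x \<in> g D'" using im by blast
      then have "D' = D" using P(3) D x g by blast
      then show "x \<in> g D" using D' by simp
    qed
  qed (use g D in blast)
  then show ?thesis using im by force
qed

lemma component_sets_empty: "component_sets V {} = (\<lambda>v. {v}) ` V"
proof -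
  have "reach V {} = Id_on V" by (auto simp: reach_def)
  then show ?thesis by (auto simp: component_sets_def quotient_def)
qed

lemma card_component_sets_insert:
  assumes fin: "finite V" and A: "\<Union>A \<subseteq> V" and uv: "u \<in> V" "v \<in> V" and no: "(u, v) \<notin> reach V A"
  shows "card (component_sets V A) = Suc (card (component_sets V (insert {u, v} A)))"
proof -
  let ?Q = "component_sets V A" and ?A = "insert {u, v} A"
  obtain Cu where Cu: "Cu \<in> ?Q" "u \<in> Cu" using uv component_sets_Union by (metis UnionE)
  obtain Cv where Cv: "Cv \<in> ?Q" "v \<in> Cv" using uv component_sets_Union by (metis UnionE)
  have ne: "Cu \<noteq> Cv"
    using no Cu Cv in_quotient_imp_in_rel[OF reach_equiv, of Cu V A u v]
    unfolding component_sets_def by blast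
  let ?P = "insert (Cu \<union> Cv) (?Q - {Cu, Cv})"
  have dis: "Cu \<inter> C = {}" "Cv \<inter> C = {}" if "C \<in> ?Q - {Cu, Cv}" for C
    using component_sets_disjoint Cu(1) Cv(1) that by blast+
  have notin: "Cu \<union> Cv \<notin> ?Q - {Cu, Cv}" using dis Cu by blast
  have finQ: "finite ?Q" using fin by (rule finite_component_sets)
  have c2: "card {Cu, Cv} = 2" using ne by simp
  have ge: "2 \<le> card ?Q" using c2 Cu Cv card_mono[OF finQ, of "{Cu, Cv}"] by auto
  have cardP: "card ?P = card ?Q - 1"
    using notin finQ Cu Cv c2 ge by (simp add: card_Diff_subset)
  \<comment> \<open>Every new component is the saturation of a block of \<open>?P\<close>. This
    gives the cardinality bound that \<open>component_sets_eqI\<close> asks for.\<close>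
  have "(\<lambda>C. (reach V ?A) `` C) ` ?P \<supseteq> component_sets V ?A"
  proof
    fix D assume D: "D \<in> component_sets V ?A"
    then obtain x where x: "x \<in> V" "D = reach V ?A `` {x}"
      unfolding component_sets_def by (auto elim: quotientE)
    have "x \<in> \<Union>?P" using x(1) component_sets_Union[of V A] by blast
    then obtain C where C: "C \<in> ?P" "x \<in> C" by blast
    have cls: "(x, y) \<in> reach V ?A" if "y \<in> C" for y
    proof -
      have r: "(a, b) \<in> reach V ?A" if "E \<in> ?Q" "a \<in> E" "b \<in> E" for a b E
      proof -
        have "(a, b) \<in> reach V A" 
          using that in_quotient_imp_in_rel[OF reach_equiv, of E V A a b]
          unfolding component_sets_def by blast
        then show ?thesis using reach_mono[of A ?A V] by blast
      qed
      have e: "(u, v) \<in> reach V ?A" using uv by (auto intro: reach_edge)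
      have xu: "(a, u) \<in> reach V ?A" if "a \<in> Cu \<union> Cv" for a
      proof (cases "a \<in> Cu")
        case True
        then show ?thesis by (rule r[OF Cu(1) _ Cu(2)])
      next
        case False
        then have "a \<in> Cv" using that by blast
        then have "(a, v) \<in> reach V ?A" by (rule r[OF Cv(1) _ Cv(2)])
        then show ?thesis using reach_trans[OF _ reach_sym[OF e]] by blast
      qed
      show ?thesis
      proof (cases "C = Cu \<union> Cv")
        case True
        then show ?thesis
          using reach_trans[OF xu[of x] reach_sym[OF xu[of y]]] C(2) that by blast
      next
        case False
        then show ?thesis using C r that by blast
      qed
    qed
    have "D = reach V ?A `` C"
    proof
      show "D \<subseteq> reach V ?A `` C" using x C(2) by blast
      show "reach V ?A `` C \<subseteq> D"
      proof
        fix z assume "z \<in> reach V ?A `` C"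
        then obtain y where "y \<in> C" "(y, z) \<in> reach V ?A" by blast
        then show "z \<in> D" using reach_trans[OF cls] x(2) by blast
      qed
    qed
    then show "D \<in> (\<lambda>C. (reach V ?A) `` C) ` ?P" using C(1) by blast
  qed
  then have le: "card (component_sets V ?A) \<le> card ?P"
    using finQ by (meson card_image_le card_mono finite.insertI finite_Diff finite_imageI le_trans)
  have "component_sets V ?A = ?P"
  proof (rule component_sets_eqI[OF fin])
    show "\<Union>?P = V" using component_sets_Union[of V A] Cu(1) Cv(1) by blast
    show "{} \<notin> ?P" using component_sets_nonempty Cu by blast
    show "C = D \<or> C \<inter> D = {}" if cd: "C \<in> ?P" "D \<in> ?P" for C D
    proof -
      consider "C = Cu \<union> Cv" "D = Cu \<union> Cv" | "C = Cu \<union> Cv" "D \<in> ?Q - {Cu, Cv}"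
        | "D = Cu \<union> Cv" "C \<in> ?Q - {Cu, Cv}" | "C \<in> ?Q" "D \<in> ?Q" using cd by blast
      then show ?thesis
        by cases (use dis in blast, use dis in blast, use dis in blast,
          use component_sets_disjoint in blast)
    qed
    show "y \<in> C" if C: "C \<in> ?P" and xy: "{x, y} \<in> ?A" "x \<in> C" for C x y
    proof -
      have y: "y \<in> V" using xy(1) A uv by (auto simp: doubleton_eq_iff)
      have e: "y \<in> E" if "E \<in> ?Q" "x \<in> E" "{x, y} \<in> A" for E
        using component_sets_edge[OF that(1,3,2) y] .
      show ?thesis
      proof (cases "{x, y} \<in> A")
        case True
        then show ?thesis using C xy(2) e Cu(1) Cv(1) by blast
      next
        case False
        then have "{x, y} = {u, v}" using xy(1) by blast
        then have "x \<in> Cu \<union> Cv" "y \<in> Cu \<union> Cv" using Cu Cv by (auto simp: doubleton_eq_iff)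
        moreover have "C = Cu \<union> Cv" using C xy(2) calculation(1) dis by blast
        ultimately show ?thesis by simp
      qed
    qed
  qed (use le in simp)
  then show ?thesis using cardP ge by simp
qed

section \<open>Branches of a tree\<close>

definition crossing :: "'a wgraph \<Rightarrow> 'a set \<Rightarrow> 'a set set" where
  "crossing G S = {e \<in> edges G. e \<inter> S \<noteq> {} \<and> \<not> e \<subseteq> S}"

text \<open>A side of a deleted tree edge, encoded as a vertex set with a one-element edge boundary.
  Complementation then visibly preserves branches and their cut edges.\<close>

definition branch :: "'a wgraph \<Rightarrow> 'a set \<Rightarrow> bool" where
  "branch G S \<longleftrightarrow> S \<subseteq> verts G \<and> is_singleton (crossing G S)"

definition cut_edge :: "'a wgraph \<Rightarrow> 'a set \<Rightarrow> 'a set" where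
  "cut_edge G S = the_elem (crossing G S)"

abbreviation wt :: "'a wgraph \<Rightarrow> 'a set \<Rightarrow> nat" where
  "wt G S \<equiv> sum (weight G) S"

text \<open>The bound is not strict, so an edge that halves the total weight contributes both of its
  sides. This is needed when the big component has exactly half of the weight.\<close>

definition light_branches :: "'a wgraph \<Rightarrow> 'a set set" where
  "light_branches G = {S. branch G S \<and> 2 * wt G S \<le> total_weight G}"

lemma crossing_doubleton:
  "{x, y} \<in> crossing G S \<longleftrightarrow> {x, y} \<in> edges G \<and> (x \<in> S) \<noteq> (y \<in> S)"
  by (auto simp: crossing_def)

locale tree =
  fixes G :: "'a wgraph"
  assumes tree: "weighted_tree G"
begin

abbreviation "V \<equiv> verts G"
abbreviation "E \<equiv> edges G"

lemma finite_verts: "finite V"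
  using tree by (auto simp: weighted_tree_def weighted_graph_def)

lemma verts_nonempty: "V \<noteq> {}"
  using tree by (auto simp: weighted_tree_def connected_graph_def)

lemma weight_pos: "v \<in> V \<Longrightarrow> weight G v > 0"
  using tree by (auto simp: weighted_tree_def weighted_graph_def)

lemma edge_subset: "e \<in> E \<Longrightarrow> e \<subseteq> V"
  using tree by (auto simp: weighted_tree_def weighted_graph_def)

lemma edgeE:
  assumes "e \<in> E"
  obtains u v where "e = {u, v}" "u \<noteq> v" "u \<in> V" "v \<in> V"
proof -
  have "card e = 2" using assms tree by (auto simp: weighted_tree_def weighted_graph_def)
  then obtain u v where "e = {u, v}" "u \<noteq> v" by (auto simp: card_2_iff)
  then show thesis using edge_subset[OF assms] that by auto
qed

lemma edge_neq: "{u, v} \<in> E \<Longrightarrow> u \<noteq> v"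
  by (erule edgeE) auto

lemma finite_edges: "finite E"
  using edge_subset finite_verts by (intro finite_subset[of E "Pow V"]) auto

lemma wt_mono: "S \<subseteq> R \<Longrightarrow> R \<subseteq> V \<Longrightarrow> wt G S \<le> wt G R"
  using finite_verts by (intro sum_mono2) (auto intro: finite_subset)

lemma wt_strict_mono: "S \<subset> R \<Longrightarrow> R \<subseteq> V \<Longrightarrow> wt G S < wt G R"
proof -
  assume *: "S \<subset> R" "R \<subseteq> V"
  then obtain x where x: "x \<in> R - S" by blast
  have "finite R" using * finite_verts finite_subset by blast
  then show ?thesis using * x weight_pos[of x] by (intro sum_strict_mono2[of R S x]) auto
qed

lemma card_le_wt: "S \<subseteq> V \<Longrightarrow> card S \<le> wt G S"
  using sum_mono[of S "\<lambda>_. 1" "weight G"] weight_pos by (force simp: Suc_le_eq)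

lemma wt_pos: "S \<subseteq> V \<Longrightarrow> S \<noteq> {} \<Longrightarrow> 0 < wt G S"
  using wt_strict_mono[of "{}" S] by (simp add: psubset_eq)

lemma wt_Diff: "S \<subseteq> V \<Longrightarrow> wt G (V - S) + wt G S = total_weight G"
  using sum.subset_diff[of S V "weight G"] finite_verts by (simp add: total_weight_def)

lemma crossing_nonempty:
  assumes "C \<subseteq> V" "C \<noteq> {}" "C \<noteq> V"
  shows "crossing G C \<noteq> {}"
proof
  assume no: "crossing G C = {}"
  obtain u v where uv: "u \<in> C" "v \<in> V" "v \<notin> C" using assms by blast
  then have "(u, v) \<in> reach V E"
    using tree assms(1) by (auto simp: weighted_tree_def connected_graph_def)
  then have "v \<in> C" using uv(1)
  proof (rule reach_closed)
    fix x y assume xy: "{x, y} \<in> E" "x \<in> C"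
    have "{x, y} \<notin> crossing G C" using no by simp
    then show "y \<in> C" using xy by (simp add: crossing_doubleton)
  qed
  with uv show False by blast
qed

text \<open>A path between the ends that avoids the edge would close up with it to a cycle; it has
  at least three vertices because its ends differ and the edge itself is excluded.\<close>

lemma edge_not_reach:
  assumes "{u, v} \<in> E"
  shows "(u, v) \<notin> reach V (E - {{u, v}})"
proof
  assume "(u, v) \<in> reach V (E - {{u, v}})"
  then have "(u, v) \<in> {(a, b). {a, b} \<in> E - {{u, v}}}\<^sup>*" by (auto simp: reach_def)
  from rtrancl_distinct_path[OF this] obtain p where p: "p \<noteq> []" "hd p = u" "last p = v"
    "distinct p" "successively (\<lambda>x y. {x, y} \<in> E - {{u, v}}) p" by auto
  have uv: "u \<noteq> v" using assms by (rule edge_neq)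
  have ends: "p ! 0 = u" "p ! (length p - 1) = v"
    using p(1-3) by (simp_all add: hd_conv_nth last_conv_nth)
  have suc: "{p ! i, p ! Suc i} \<in> E - {{u, v}}" if "Suc i < length p" for i
    using p(5) that by (simp add: successively_conv_nth)
  have len: "3 \<le> length p"
  proof (rule ccontr)
    assume "\<not> 3 \<le> length p"
    then have "length p = 1 \<or> length p = 2" using p(1) by (cases "length p") auto
    then show False
    proof
      assume "length p = 1"
      then show False using ends uv by simp
    next
      assume "length p = 2"
      then show False using ends suc[of 0] by simp
    qed
  qed
  have "is_cycle G p"
    unfolding is_cycle_def
  proof (intro conjI allI impI len p(4))
    fix i assume i: "i < length p"
    show "{p ! i, p ! (Suc i mod length p)} \<in> E"
    proof (cases "Suc i < length p")
      case True
      then show ?thesis using suc by simp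
    next
      case False
      then have "Suc i = length p" using i by simp
      then have "p ! (Suc i mod length p) = u" "p ! i = v" using ends by (auto simp flip: \<open>Suc i = length p\<close>)
      then show ?thesis using assms by (simp add: insert_commute)
    qed
  qed
  then show False using tree by (auto simp: weighted_tree_def)
qed

text \<open>Each added edge joins two different components, as its ends are not connected by the
  other edges. Hence the exponent of \<open>z - 1\<close> vanishes, and components can be counted by
  counting edges.\<close>

lemma card_component_sets:
  assumes "A \<subseteq> E"
  shows "card A + card (component_sets V A) = card V"
proof -
  have "finite A" using assms finite_edges finite_subset by blast
  then show ?thesis using assms
  proof (induction A rule: finite_induct)
    case empty
    show ?case by (simp add: component_sets_empty card_image)
  next
    case (insert e A)
    then obtain u v where e: "e = {u, v}" "u \<in> V" "v \<in> V" by (meson edgeE insert_subset)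
    have "(u, v) \<notin> reach V A"
      using edge_not_reach[of u v] reach_mono[of A "E - {{u, v}}" V] insert e by blast
    then have "card (component_sets V A) = Suc (card (component_sets V (insert e A)))"
      unfolding e(1) using finite_verts insert.prems edge_subset e(2,3)
      by (intro card_component_sets_insert) auto
    then show ?case using insert by simp
  qed
qed

lemma branch_subset: "branch G S \<Longrightarrow> S \<subseteq> V"
  by (simp add: branch_def)

lemma crossing_branch: "branch G S \<Longrightarrow> crossing G S = {cut_edge G S}"
  by (auto simp: branch_def cut_edge_def is_singleton_the_elem)

lemma branchI: "S \<subseteq> V \<Longrightarrow> crossing G S = {e} \<Longrightarrow> branch G S \<and> cut_edge G S = e"
  by (simp add: branch_def cut_edge_def)

lemma cut_edge_in: "branch G S \<Longrightarrow> cut_edge G S \<in> E"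
  using crossing_branch[of S] by (auto simp: crossing_def)

lemma branchE:
  assumes "branch G S"
  obtains r p where "cut_edge G S = {r, p}" "r \<in> S" "p \<in> V" "p \<notin> S"
proof -
  have cr: "cut_edge G S \<in> crossing G S" using crossing_branch[OF assms] by simp
  obtain u v where uv: "cut_edge G S = {u, v}" "u \<in> V" "v \<in> V"
    using cut_edge_in[OF assms] by (meson edgeE)
  then have "(u \<in> S) \<noteq> (v \<in> S)" using cr crossing_doubleton by metis
  then show thesis using that[of u v] that[of v u] uv by (auto simp: insert_commute)
qed

lemma branch_nonempty: "branch G S \<Longrightarrow> S \<noteq> {}"
  by (erule branchE) auto

lemma branch_neq_verts: "branch G S \<Longrightarrow> S \<noteq> V"
  by (erule branchE) auto

lemma branch_crosses:
  assumes "branch G S" "{x, y} \<in> E" "x \<in> S" "y \<notin> S"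
  shows "cut_edge G S = {x, y}"
proof -
  have "{x, y} \<in> crossing G S" using assms(2-4) by (simp add: crossing_doubleton)
  then show ?thesis using crossing_branch[OF assms(1)] by simp
qed

lemma crossing_compl: "crossing G (V - S) = crossing G S"
proof -
  have "e \<in> crossing G (V - S) \<longleftrightarrow> e \<in> crossing G S" if e: "e \<in> E" for e
  proof -
    obtain u v where "e = {u, v}" "u \<in> V" "v \<in> V" using e by (meson edgeE)
    then show ?thesis by (auto simp: crossing_doubleton)
  qed
  then show ?thesis by (auto simp: crossing_def)
qed

lemma branch_compl: "branch G S \<Longrightarrow> branch G (V - S)"
  by (simp add: branch_def crossing_compl)

lemma cut_edge_compl: "cut_edge G (V - S) = cut_edge G S"
  by (simp add: cut_edge_def crossing_compl)

text \<open>An edge crossing the symmetric difference crosses exactly one of the two sets. So no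
  edge crosses it, and by connectedness it is empty or all of \<open>V\<close>.\<close>

lemma crossing_eq:
  assumes "S \<subseteq> V" "R \<subseteq> V" "crossing G S = crossing G R"
  shows "S = R \<or> S = V - R"
proof -
  let ?D = "(S - R) \<union> (R - S)"
  have "e \<notin> crossing G ?D" for e
  proof
    assume e: "e \<in> crossing G ?D"
    then have "e \<in> E" by (simp add: crossing_def)
    then obtain u v where uv: "e = {u, v}" by (meson edgeE)
    have "e \<in> crossing G S \<longleftrightarrow> e \<in> crossing G R" using assms by simp
    then show False using e unfolding uv crossing_doubleton by blast
  qed
  then have "?D = {} \<or> ?D = V" using crossing_nonempty[of ?D] assms by blast
  then show ?thesis using assms by blast
qed

lemma cut_edge_eq:
  "branch G S \<Longrightarrow> branch G R \<Longrightarrow> cut_edge G S = cut_edge G R \<Longrightarrow> S = R \<or> S = V - R"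
  by (intro crossing_eq) (simp_all add: branch_subset crossing_branch)

text \<open>Otherwise all four corners are nonempty, and each contains an end of one of the two cut
  edges. A single common cut edge has too few ends. If the cut edges differ, \<open>a\<close> and
  \<open>b\<close> lie on the same side of \<open>R\<close>, so both corners on its other side would
  have to be met by \<open>c\<close> or \<open>d\<close>; but these lie on the same side of
  \<open>S\<close>, which separates those two corners.\<close>

lemma branch_trichotomy:
  assumes S: "branch G S" and R: "branch G R"
  shows "S \<subseteq> R \<or> R \<subseteq> S \<or> S \<inter> R = {} \<or> S \<union> R = V"
proof (rule ccontr)
  assume contra: "\<not> ?thesis"
  obtain a b where ab: "cut_edge G S = {a, b}" "a \<in> S" "b \<in> V" "b \<notin> S" using S by (rule branchE)
  obtain c d where cd: "cut_edge G R = {c, d}" "c \<in> R" "d \<in> V" "d \<notin> R" using R by (rule branchE)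
  have sub: "S \<subseteq> V" "R \<subseteq> V" using S R branch_subset by auto
  have cr: "{x, y} = {a, b} \<or> {x, y} = {c, d}"
    if "{x, y} \<in> E" "(x \<in> S) \<noteq> (y \<in> S) \<or> (x \<in> R) \<noteq> (y \<in> R)" for x y
  proof -
    have "{x, y} \<in> crossing G S \<or> {x, y} \<in> crossing G R"
      using that unfolding crossing_doubleton by blast
    then show ?thesis using crossing_branch[OF S] crossing_branch[OF R] ab(1) cd(1) by simp
  qed
  have corner: "\<exists>z\<in>{a, b, c, d}. z \<in> C"
    if C: "C \<in> {S \<inter> R, S - R, R - S, V - (S \<union> R)}" for C
  proof -
    have "C \<subseteq> V" "C \<noteq> {}" "C \<noteq> V" using C contra sub by blast+
    then obtain e where e: "e \<in> crossing G C" using crossing_nonempty by blast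
    then have "e \<in> E" by (simp add: crossing_def)
    then obtain x y where xy: "e = {x, y}" "x \<in> V" "y \<in> V" by (meson edgeE)
    then have d: "(x \<in> C) \<noteq> (y \<in> C)" using e crossing_doubleton by metis
    then have "(x \<in> S) \<noteq> (y \<in> S) \<or> (x \<in> R) \<noteq> (y \<in> R)" using C xy by blast
    then have "{x, y} = {a, b} \<or> {x, y} = {c, d}" using cr \<open>e \<in> E\<close> xy by blast
    then show ?thesis using d by (auto simp: doubleton_eq_iff)
  qed
  show False
  proof (cases "{a, b} = {c, d}")
    case True
    then show False using corner[of "S \<inter> R"] corner[of "S - R"] corner[of "R - S"]
        corner[of "V - (S \<union> R)"] ab cd by (auto simp: doubleton_eq_iff)
  next
    case False
    then have "a \<in> R \<longleftrightarrow> b \<in> R" "c \<in> S \<longleftrightarrow> d \<in> S"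
      using branch_crosses[OF R, of a b] branch_crosses[OF R, of b a]
        branch_crosses[OF S, of c d] branch_crosses[OF S, of d c] ab cd
        cut_edge_in[OF S] cut_edge_in[OF R] by (auto simp: insert_commute)
    then show False using corner[of "S \<inter> R"] corner[of "S - R"] corner[of "R - S"]
        corner[of "V - (S \<union> R)"] ab cd by blast
  qed
qed

text \<open>The witness is the complement of the component of \<open>x\<close> after deleting
  \<open>e\<close>. Stating the conclusion by reachability allows a whole component around
  \<open>x\<close> to be avoided, not just \<open>x\<close>.\<close>

lemma branch_avoiding:
  assumes "e \<in> E" "x \<in> V"
  shows "\<exists>S. branch G S \<and> cut_edge G S = e \<and> (\<forall>y\<in>S. (x, y) \<notin> reach V (E - {e}))"
proof -
  let ?S = "V - reach V (E - {e}) `` {x}"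
  have "e' \<notin> crossing G ?S" if "e' \<noteq> e" for e'
  proof
    assume c: "e' \<in> crossing G ?S"
    then have e': "e' \<in> E" by (simp add: crossing_def)
    then obtain u v where uv: "e' = {u, v}" "u \<in> V" "v \<in> V" by (meson edgeE)
    then have "(u, v) \<in> reach V (E - {e})" using e' that by (intro reach_edge) auto
    then have "(x, u) \<in> reach V (E - {e}) \<longleftrightarrow> (x, v) \<in> reach V (E - {e})"
      using reach_trans reach_sym by metis
    then show False using c uv unfolding uv(1) crossing_doubleton by blast
  qed
  then have sub: "crossing G ?S \<subseteq> {e}" by blast
  obtain u v where uv: "e = {u, v}" "u \<in> V" "v \<in> V" using assms(1) by (meson edgeE)
  have "(u, v) \<notin> reach V (E - {e})" using edge_not_reach assms(1) uv by simp
  then have "u \<in> ?S \<or> v \<in> ?S" using uv reach_trans reach_sym by (metis DiffI Image_singleton_iff)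
  moreover have "x \<notin> ?S" using assms(2) by (auto simp: reach_def)
  ultimately have "crossing G ?S \<noteq> {}" using assms(2) by (intro crossing_nonempty) auto
  then have "crossing G ?S = {e}" using sub by blast
  then show ?thesis using branchI[of ?S e] by blast
qed

lemma light_branchD:
  "S \<in> light_branches G \<Longrightarrow> branch G S" "S \<in> light_branches G \<Longrightarrow> 2 * wt G S \<le> total_weight G"
  by (simp_all add: light_branches_def)

lemma finite_light_branches: "finite (light_branches G)"
  by (rule finite_subset[of _ "Pow V"])
    (use finite_verts in \<open>auto simp: light_branches_def branch_def\<close>)

text \<open>Only two overlapping branches with union \<open>V\<close> have to be excluded: their
  overlap has positive weight and is counted twice, so the two weights would add up to more than the
  total.\<close>

lemma light_branches_laminar:
  assumes "S \<in> light_branches G" "R \<in> light_branches G"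
  shows "S \<subseteq> R \<or> R \<subseteq> S \<or> S \<inter> R = {}"
proof (rule ccontr)
  assume c: "\<not> ?thesis"
  have sub: "S \<subseteq> V" "R \<subseteq> V" using assms light_branchD branch_subset by blast+
  have "S \<union> R = V" using branch_trichotomy[of S R] c assms light_branchD by blast
  then have "wt G V < wt G S + wt G R"
  proof -
    have fin: "finite S" "finite R" using sub finite_verts finite_subset by blast+
    have "wt G (S \<inter> R) > 0" using c sub by (intro wt_pos) auto
    then show ?thesis using sum.union_inter[OF fin, of "weight G"] \<open>S \<union> R = V\<close> by simp
  qed
  then show False using light_branchD(2)[OF assms(1)] light_branchD(2)[OF assms(2)]
    by (simp add: total_weight_def)
qed

end

section \<open>Families of branches\<close>

definition laminar :: "'a set set \<Rightarrow> bool" where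
  "laminar \<U> \<longleftrightarrow> (\<forall>S\<in>\<U>. \<forall>R\<in>\<U>. S \<subseteq> R \<or> R \<subseteq> S \<or> S \<inter> R = {})"

text \<open>For a laminar family of branches that does not cover all vertices, this is the component
  containing the inner end of the cut edge of \<open>S\<close> once all cut edges of the family are
  removed.\<close>

definition part :: "'a set set \<Rightarrow> 'a set \<Rightarrow> 'a set" where
  "part \<U> S = S - \<Union>{R \<in> \<U>. R \<subset> S}"

lemma laminarD: "laminar \<U> \<Longrightarrow> S \<in> \<U> \<Longrightarrow> R \<in> \<U> \<Longrightarrow> S \<subseteq> R \<or> R \<subseteq> S \<or> S \<inter> R = {}"
  unfolding laminar_def by blast

lemma laminar_subset: "laminar \<U> \<Longrightarrow> \<W> \<subseteq> \<U> \<Longrightarrow> laminar \<W>"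
  unfolding laminar_def by blast

lemma part_subset: "part \<U> S \<subseteq> S"
  by (auto simp: part_def)

lemma part_disjoint:
  assumes "laminar \<U>" "S \<in> \<U>" "R \<in> \<U>" "S \<noteq> R"
  shows "part \<U> S \<inter> part \<U> R = {}"
proof -
  consider "S \<subset> R" | "R \<subset> S" | "S \<inter> R = {}"
    using assms unfolding laminar_def by blast
  then show ?thesis by cases (use assms in \<open>auto simp: part_def\<close>)
qed

text \<open>A point lies in the part of a smallest member containing it. The downward closed
  subfamily \<open>\<W>\<close> covers both the whole family and the members below a fixed
  one.\<close>

lemma Union_part:
  assumes "finite \<U>" "\<W> \<subseteq> \<U>" "\<And>S R. S \<in> \<W> \<Longrightarrow> R \<in> \<U> \<Longrightarrow> R \<subset> S \<Longrightarrow> R \<in> \<W>"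
  shows "\<Union>(part \<U> ` \<W>) = \<Union>\<W>"
proof
  show "\<Union>(part \<U> ` \<W>) \<subseteq> \<Union>\<W>" using part_subset by fastforce
  show "\<Union>\<W> \<subseteq> \<Union>(part \<U> ` \<W>)"
  proof
    fix x assume "x \<in> \<Union>\<W>"
    then have ne: "{S \<in> \<W>. x \<in> S} \<noteq> {}" by blast
    have "finite {S \<in> \<W>. x \<in> S}" using assms(1,2) by (auto intro: finite_subset)
    from finite_has_minimal[OF this ne] obtain S where S: "S \<in> \<W>" "x \<in> S"
      "\<And>R. R \<in> \<W> \<Longrightarrow> x \<in> R \<Longrightarrow> R \<subseteq> S \<Longrightarrow> S = R" by auto
    then have "x \<in> part \<U> S" unfolding part_def using assms(3)[OF S(1)] by blast
    then show "x \<in> \<Union>(part \<U> ` \<W>)" using S(1) by blast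
  qed
qed

lemma sum_parts:
  assumes "finite \<U>" "\<And>S. S \<in> \<U> \<Longrightarrow> finite S" "laminar \<U>" "\<W> \<subseteq> \<U>"
    "\<And>S R. S \<in> \<W> \<Longrightarrow> R \<in> \<U> \<Longrightarrow> R \<subset> S \<Longrightarrow> R \<in> \<W>"
  shows "(\<Sum>S\<in>\<W>. sum f (part \<U> S)) = sum f (\<Union>\<W>)"
proof -
  have "sum f (\<Union>(part \<U> ` \<W>)) = (\<Sum>S\<in>\<W>. sum f (part \<U> S))"
    using assms(1-4) part_disjoint[OF assms(3)]
    by (intro sum.UNION_disjoint) (meson finite_subset part_subset subsetD)+
  then show ?thesis using Union_part[of \<U> \<W>] assms by simp
qed

lemma sum_parts_below:
  assumes "finite \<U>" "\<And>S. S \<in> \<U> \<Longrightarrow> finite S" "laminar \<U>" "S \<in> \<U>"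
  shows "(\<Sum>R | R \<in> \<U> \<and> R \<subseteq> S. sum f (part \<U> R)) = sum f S"
proof -
  have "\<Union>{R \<in> \<U>. R \<subseteq> S} = S" using assms(4) by blast
  then show ?thesis using sum_parts[OF assms(1-3), of "{R \<in> \<U>. R \<subseteq> S}" f] by auto
qed

definition component_weights :: "'a wgraph \<Rightarrow> 'a set set \<Rightarrow> nat multiset" where
  "component_weights G A = image_mset (wt G) (mset_set (component_sets (verts G) A))"

definition part_weights :: "'a wgraph \<Rightarrow> 'a set set \<Rightarrow> nat multiset" where
  "part_weights G \<U> = image_mset (\<lambda>S. wt G (part \<U> S)) (mset_set \<U>)"

text \<open>Marking a component \<open>K\<close> removes the ambiguity that arises when several
  components have the same weight; \<open>M\<close> collects the weights of the unmarked
  ones.\<close>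

definition cut_pairs :: "'a wgraph \<Rightarrow> nat multiset \<Rightarrow> ('a set set \<times> 'a set) set" where
  "cut_pairs G M = {(A, K). A \<subseteq> edges G \<and> K \<in> component_sets (verts G) A \<and>
     component_weights G A = add_mset (wt G K) M}"

definition branch_families :: "'a wgraph \<Rightarrow> nat multiset \<Rightarrow> 'a set set set" where
  "branch_families G M = {\<U>. \<U> \<subseteq> light_branches G \<and> part_weights G \<U> = M}"

context tree
begin

lemma laminar_light: "laminar (light_branches G)"
  using light_branches_laminar unfolding laminar_def by blast

lemma finite_branches: "(\<And>S. S \<in> \<U> \<Longrightarrow> branch G S) \<Longrightarrow> finite \<U>"
  by (rule finite_subset[of _ "Pow V"]) (use finite_verts branch_subset in auto)

lemma finite_branch: "branch G S \<Longrightarrow> finite S"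
  using finite_verts branch_subset finite_subset by metis

lemma component_sets_edges: "component_sets V E = {V}"
proof -
  have "reach V E = V \<times> V"
    using tree by (auto simp: weighted_tree_def connected_graph_def reach_def)
  then show ?thesis using verts_nonempty by (auto simp: component_sets_def quotient_def)
qed

lemma sum_component_weights: "sum_mset (component_weights G A) = total_weight G"
proof -
  have "sum (wt G) (component_sets V A) = sum (weight G) (\<Union>(component_sets V A))"
  proof -
    have "\<forall>C\<in>component_sets V A. finite C"
      using component_sets_subset finite_verts finite_subset by metis
    moreover have "\<forall>C\<in>component_sets V A. \<forall>D\<in>component_sets V A. C \<noteq> D \<longrightarrow> C \<inter> D = {}"
      using component_sets_disjoint by metis
    ultimately show ?thesis
      using sum.Union_disjoint[of "component_sets V A" "weight G"] by simp
  qed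
  then show ?thesis
    by (simp add: component_weights_def component_sets_Union total_weight_def sum_unfold_sum_mset)
qed

text \<open>Two different branches with the same cut edge are complementary and would cover
  \<open>V\<close>.\<close>

lemma inj_cut_edge:
  assumes "\<And>S. S \<in> \<U> \<Longrightarrow> branch G S" "\<Union>\<U> \<noteq> V"
  shows "inj_on (cut_edge G) \<U>"
proof
  fix S R assume SR: "S \<in> \<U>" "R \<in> \<U>" "cut_edge G S = cut_edge G R"
  show "S = R"
  proof (rule ccontr)
    assume "S \<noteq> R"
    then have "S = V - R" using cut_edge_eq assms(1) SR by blast
    then have "V \<subseteq> \<Union>\<U>" using SR(1,2) by blast
    then show False using assms branch_subset by blast
  qed
qed

text \<open>A smaller member containing \<open>r\<close> would be left by the edge from
  \<open>r\<close> to \<open>p\<close>, hence would have the same cut edge as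
  \<open>S\<close>.\<close>

lemma root_in_part:
  assumes "\<And>S. S \<in> \<U> \<Longrightarrow> branch G S" "inj_on (cut_edge G) \<U>" "S \<in> \<U>"
    and "cut_edge G S = {r, p}" "r \<in> S" "p \<notin> S"
  shows "r \<in> part \<U> S"
proof -
  have "r \<notin> R" if R: "R \<in> \<U>" "R \<subset> S" for R
  proof
    assume "r \<in> R"
    moreover have "{r, p} \<in> E" using cut_edge_in[of S] assms(1,3,4) by simp
    ultimately have "cut_edge G R = {r, p}" using branch_crosses[of R r p] assms R by blast
    then show False using assms R by (metis inj_onD psubset_eq)
  qed
  then show ?thesis using assms(5) by (auto simp: part_def)
qed

lemma part_nonempty:
  assumes "\<And>S. S \<in> \<U> \<Longrightarrow> branch G S" "inj_on (cut_edge G) \<U>" "S \<in> \<U>"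
  shows "part \<U> S \<noteq> {}"
proof -
  obtain r p where "cut_edge G S = {r, p}" "r \<in> S" "p \<in> V" "p \<notin> S"
    using assms(1,3) by (meson branchE)
  then show ?thesis using root_in_part[OF assms] by blast
qed

lemma inj_part:
  assumes "\<And>S. S \<in> \<U> \<Longrightarrow> branch G S" "inj_on (cut_edge G) \<U>" "laminar \<U>"
  shows "inj_on (part \<U>) \<U>"
proof
  fix S R assume "S \<in> \<U>" "R \<in> \<U>" "part \<U> S = part \<U> R"
  then show "S = R" using part_disjoint[OF assms(3)] part_nonempty[OF assms(1,2)] by (metis inf.idem)
qed

text \<open>No remaining edge separates two of the proposed blocks, so they are unions of
  components. There are \<open>card \<U> + 1\<close> blocks, and removing \<open>card \<U>\<close>
  edges from a tree leaves equally many components.\<close>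

lemma component_sets_branches:
  assumes br: "\<And>S. S \<in> \<U> \<Longrightarrow> branch G S" and lam: "laminar \<U>" and ne: "\<Union>\<U> \<noteq> V"
  shows "component_sets V (E - cut_edge G ` \<U>) = insert (V - \<Union>\<U>) (part \<U> ` \<U>)"
    and "V - \<Union>\<U> \<notin> part \<U> ` \<U>"
proof -
  let ?A = "E - cut_edge G ` \<U>" and ?P = "insert (V - \<Union>\<U>) (part \<U> ` \<U>)"
  note inj = inj_cut_edge[OF br ne]
  have fin: "finite \<U>" using br by (rule finite_branches)
  have sub: "\<Union>\<U> \<subseteq> V" using br branch_subset by blast
  have neP: "part \<U> S \<noteq> {}" "part \<U> S \<subseteq> \<Union>\<U>" if "S \<in> \<U>" for S
    using part_nonempty[OF br inj that] part_subset[of \<U> S] that by auto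
  then show notin: "V - \<Union>\<U> \<notin> part \<U> ` \<U>" by blast
  show "component_sets V ?A = ?P"
  proof (rule component_sets_eqI[OF finite_verts])
    show "\<Union>?P = V" using Union_part[of \<U> \<U>] fin sub by auto
    show "{} \<notin> ?P" using neP(1) ne sub by blast
    show "C = D \<or> C \<inter> D = {}" if "C \<in> ?P" "D \<in> ?P" for C D
      using that part_disjoint[OF lam] neP(2) by fast
    have same: "x \<in> S \<longleftrightarrow> y \<in> S" if "{x, y} \<in> ?A" "S \<in> \<U>" for x y S
      using that branch_crosses[OF br, of S x y] branch_crosses[OF br, of S y x]
      by (auto simp: insert_commute)
    show "y \<in> C" if "C \<in> ?P" "{x, y} \<in> ?A" "x \<in> C" for C x y
    proof -
      have "y \<in> V" using that(2) edge_subset by blast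
      then show ?thesis using that same[OF that(2)] unfolding part_def by blast
    qed
    have "card ?P = Suc (card \<U>)"
      using notin fin inj_part[OF br inj lam] by (simp add: card_image)
    moreover have "card (component_sets V ?A) = Suc (card \<U>)"
    proof -
      have ce: "cut_edge G ` \<U> \<subseteq> E" using br cut_edge_in by blast
      then have "card ?A + card \<U> = card E"
        using inj fin finite_edges card_mono[OF finite_edges ce]
        by (simp add: card_Diff_subset card_image)
      moreover have "card E + 1 = card V"
        using card_component_sets[of E] component_sets_edges by simp
      ultimately show ?thesis using card_component_sets[of ?A] by simp
    qed
    ultimately show "card (component_sets V ?A) \<le> card ?P" by simp
  qed
qed


lemma component_weights_branches:
  assumes "\<And>S. S \<in> \<U> \<Longrightarrow> branch G S" "laminar \<U>" "\<Union>\<U> \<noteq> V"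
  shows "component_weights G (E - cut_edge G ` \<U>) = add_mset (wt G (V - \<Union>\<U>)) (part_weights G \<U>)"
proof -
  have fin: "finite (part \<U> ` \<U>)" using finite_branches assms(1) by blast
  have "mset_set (part \<U> ` \<U>) = image_mset (part \<U>) (mset_set \<U>)"
    using inj_part[OF assms(1) inj_cut_edge[OF assms(1,3)] assms(2)] by (simp add: image_mset_mset_set)
  then show ?thesis
    unfolding component_weights_def part_weights_def
    using component_sets_branches[OF assms] fin
    by (simp add: image_mset.compositionality o_def)
qed

lemma sum_part_weights:
  assumes "\<And>S. S \<in> \<U> \<Longrightarrow> branch G S" "laminar \<U>"
  shows "sum_mset (part_weights G \<U>) = wt G (\<Union>\<U>)"
  using sum_parts[of \<U> \<U> "weight G"] finite_branches finite_branch assms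
  by (simp add: part_weights_def sum_unfold_sum_mset[symmetric])

text \<open>Once the component \<^term>\<open>K\<close> of at least half of the total weight has been singled out, each
  removed edge is determined by the light branch on its far side from \<^term>\<open>K\<close>.\<close>

lemma bij_betw_branch_families_cut_pairs:
  assumes M: "2 * sum_mset M \<le> total_weight G"
  shows "bij_betw (\<lambda>\<U>. (E - cut_edge G ` \<U>, V - \<Union>\<U>)) (branch_families G M) (cut_pairs G M)"
    (is "bij_betw ?f _ _")
proof -
  have fam: "(\<forall>S\<in>\<U>. branch G S) \<and> laminar \<U> \<and> \<Union>\<U> \<subseteq> V \<and> \<Union>\<U> \<noteq> V"
    if "\<U> \<in> branch_families G M" for \<U>
  proof -
    have \<U>: "\<U> \<subseteq> light_branches G" "part_weights G \<U> = M"
      using that by (auto simp: branch_families_def)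
    then have br: "\<And>S. S \<in> \<U> \<Longrightarrow> branch G S" using light_branchD by blast
    have lam: "laminar \<U>" using laminar_subset[OF laminar_light \<U>(1)] .
    have "2 * wt G (\<Union>\<U>) \<le> total_weight G" using sum_part_weights[OF br lam] \<U>(2) M by simp
    moreover have "0 < wt G V" using wt_pos[of V] verts_nonempty by simp
    ultimately have "\<Union>\<U> \<noteq> V" by (auto simp: total_weight_def)
    then show ?thesis using br lam branch_subset by blast
  qed
  show ?thesis
    unfolding bij_betw_def
  proof
    have le: "\<U> \<subseteq> \<W>"
      if f: "\<U> \<in> branch_families G M" "\<W> \<in> branch_families G M" and eq: "?f \<U> = ?f \<W>" for \<U> \<W>
    proof
      fix S assume S: "S \<in> \<U>"
      have brs: "\<And>S. S \<in> \<U> \<Longrightarrow> branch G S" "\<And>S. S \<in> \<W> \<Longrightarrow> branch G S" 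
        and sub: "\<Union>\<U> \<subseteq> V" "\<Union>\<W> \<subseteq> V" "\<Union>\<U> \<noteq> V" using fam f by blast+
      then have "cut_edge G ` \<U> \<subseteq> E" "cut_edge G ` \<W> \<subseteq> E" using cut_edge_in by blast+
      moreover have "E - (E - cut_edge G ` \<U>) = E - (E - cut_edge G ` \<W>)" using eq by simp
      ultimately have "cut_edge G ` \<U> = cut_edge G ` \<W>" by (simp add: double_diff)
      then obtain R where R: "R \<in> \<W>" "cut_edge G S = cut_edge G R" using S by blast
      have "V - (V - \<Union>\<U>) = V - (V - \<Union>\<W>)" using eq by simp
      then have U: "\<Union>\<U> = \<Union>\<W>" using sub by (simp add: double_diff)
      \<comment> \<open>Branches with the same cut edge are equal or complementary; in the latter
        case the common union of the two families would be \<open>V\<close>.\<close>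
      have "S \<noteq> V - R"
      proof
        assume "S = V - R"
        then have "V \<subseteq> \<Union>\<U>" using U S R(1) by blast
        then show False using sub by blast
      qed
      then show "S \<in> \<W>" using cut_edge_eq[OF brs(1)[OF S] brs(2)[OF R(1)] R(2)] R(1) by blast
    qed
    show "inj_on ?f (branch_families G M)"
    proof
      fix \<U> \<W> assume *: "\<U> \<in> branch_families G M" "\<W> \<in> branch_families G M" "?f \<U> = ?f \<W>"
      show "\<U> = \<W>" using le[OF *] le[OF *(2,1) *(3)[symmetric]] by blast
    qed
    show "?f ` branch_families G M = cut_pairs G M"
    proof
      show "?f ` branch_families G M \<subseteq> cut_pairs G M"
      proof
        fix AK assume "AK \<in> ?f ` branch_families G M"
        then obtain \<U> where \<U>: "\<U> \<in> branch_families G M" "AK = ?f \<U>" by blast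
        have f: "\<And>S. S \<in> \<U> \<Longrightarrow> branch G S" "laminar \<U>" "\<Union>\<U> \<noteq> V" using fam[OF \<U>(1)] by blast+
        show "AK \<in> cut_pairs G M"
          using \<U> component_sets_branches(1)[OF f] component_weights_branches[OF f]
          by (auto simp: cut_pairs_def branch_families_def)
      qed
      show "cut_pairs G M \<subseteq> ?f ` branch_families G M"
      proof
        fix AK assume "AK \<in> cut_pairs G M"
        then obtain A K where AK: "AK = (A, K)" "A \<subseteq> E" "K \<in> component_sets V A"
          "component_weights G A = add_mset (wt G K) M" by (auto simp: cut_pairs_def)
        have tot: "wt G K + sum_mset M = total_weight G"
          using sum_component_weights[of A] AK(4) by simp
        have KV: "K \<subseteq> V" using AK(3) by (rule component_sets_subset)
        obtain x where x: "x \<in> K" using component_sets_nonempty[OF AK(3)] by blast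
        \<comment> \<open>The component \<open>K\<close> stays connected when only \<open>e\<close>
          is deleted, so it lies entirely on one side; the other side is the wanted branch.\<close>
        have "\<exists>S. branch G S \<and> cut_edge G S = e \<and> S \<inter> K = {}" if e: "e \<in> E - A" for e
        proof -
          obtain S where S: "branch G S" "cut_edge G S = e"
            "\<And>y. y \<in> S \<Longrightarrow> (x, y) \<notin> reach V (E - {e})"
            using branch_avoiding[of e x] e x KV by blast
          have "(x, y) \<in> reach V (E - {e})" if "y \<in> K" for y
          proof -
            have "(x, y) \<in> reach V A"
              using AK(3) x that in_quotient_imp_in_rel[OF reach_equiv, of K V A x y]
              unfolding component_sets_def by blast
            then show ?thesis using reach_mono[of A "E - {e}" V] AK(2) e by blast
          qed
          then show ?thesis using S by blast
        qed
        then obtain s where s: "\<And>e. e \<in> E - A \<Longrightarrow> branch G (s e) \<and> cut_edge G (s e) = e \<and> s e \<inter> K = {}"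
          by metis
        let ?U = "s ` (E - A)"
        have br: "\<And>S. S \<in> ?U \<Longrightarrow> branch G S" using s by blast
        \<comment> \<open>The far sides lie in \<open>V - K\<close>, whose weight is
          \<open>sum_mset M\<close> and so at most half of the total.\<close>
        have light: "?U \<subseteq> light_branches G"
        proof
          fix S assume S: "S \<in> ?U"
          then have "S \<subseteq> V - K" using s branch_subset by blast
          then have "wt G S \<le> wt G (V - K)" using wt_mono by simp
          then have "2 * wt G S \<le> total_weight G" using wt_Diff[OF KV] tot M by simp
          then show "S \<in> light_branches G" using br[OF S] by (simp add: light_branches_def)
        qed
        have lam: "laminar ?U" using laminar_subset[OF laminar_light light] .
        have dis: "\<Union>?U \<inter> K = {}" using s by blast
        then have ne: "\<Union>?U \<noteq> V" using x KV by blast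
        have "cut_edge G ` ?U = E - A" using s by force
        then have A: "E - cut_edge G ` ?U = A" using AK(2) by blast
        have "V - \<Union>?U \<in> component_sets V A"
          using component_sets_branches(1)[OF br lam ne] A by simp
        then have K: "V - \<Union>?U = K"
        proof -
          have "x \<in> (V - \<Union>?U) \<inter> K" using x KV dis by auto
          then show ?thesis
            using component_sets_disjoint[OF \<open>V - \<Union>?U \<in> component_sets V A\<close> AK(3)] by auto
        qed
        have "part_weights G ?U = M"
          using component_weights_branches[OF br lam ne] A K AK(4) by simp
        then have "?U \<in> branch_families G M" using light by (simp add: branch_families_def)
        then show "AK \<in> ?f ` branch_families G M" using A K AK(1) by blast
      qed
    qed
  qed
qed

end

section \<open>Coefficients of the polynomial\<close>

definition weights_monomial :: "nat multiset \<Rightarrow> (indet \<Rightarrow>\<^sub>0 nat)" where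
  "weights_monomial P = (\<Sum>n\<in>#P. Poly_Mapping.single (Xvar n) 1)"

lemma lookup_weights_monomial: "Poly_Mapping.lookup (weights_monomial P) (Xvar n) = count P n"
  by (induction P) (auto simp: weights_monomial_def Poly_Mapping.lookup_add Poly_Mapping.lookup_single when_def)

lemma weights_monomial_eq_iff: "weights_monomial P = weights_monomial Q \<longleftrightarrow> P = Q"
  by (metis lookup_weights_monomial multiset_eqI)

lemma prod_var_Xvar:
  "finite Q \<Longrightarrow> (\<Prod>C\<in>Q. var (Xvar (f C))) =
    Poly_Mapping.single (weights_monomial (image_mset f (mset_set Q))) 1"
  by (induction Q rule: finite_induct)
    (auto simp: weights_monomial_def var_def mult_single)

context tree
begin

lemma W_poly_eq:
  "W_poly G = (\<Sum>A\<in>Pow E. Poly_Mapping.single (weights_monomial (component_weights G A)) 1)"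
  unfolding W_poly_def
proof (rule sum.cong)
  fix A assume "A \<in> Pow E"
  then show "x_mon G A * (var Zvar - 1) ^ (card A + card (component_sets V A) - card V) =
      Poly_Mapping.single (weights_monomial (component_weights G A)) 1"
    using card_component_sets[of A] finite_component_sets[OF finite_verts]
    by (simp add: x_mon_def prod_var_Xvar component_weights_def)
qed simp

lemma lookup_W_poly:
  "Poly_Mapping.lookup (W_poly G) (weights_monomial P) = int (card {A. A \<subseteq> E \<and> component_weights G A = P})"
proof -
  have "Poly_Mapping.lookup (W_poly G) (weights_monomial P) =
      (\<Sum>A\<in>Pow E. if component_weights G A = P then 1 else 0)"
    unfolding W_poly_eq Poly_Mapping.lookup_sum
    by (intro sum.cong) (auto simp: Poly_Mapping.lookup_single when_def weights_monomial_eq_iff)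
  also have "\<dots> = int (card {A \<in> Pow E. component_weights G A = P})"
    using finite_edges by (simp add: sum.If_cases Int_def)
  finally show ?thesis by simp
qed

text \<open>The total weight forces the marked component to have weight \<open>k\<close>. The number
  of components that can be marked is the multiplicity of \<open>k\<close>, which depends on
  \<open>M\<close> and \<open>k\<close> alone, so the coefficient determines the number of
  pairs.\<close>

lemma card_cut_pairs:
  assumes "k + sum_mset M = total_weight G"
  shows "card (cut_pairs G M) =
    card {A. A \<subseteq> E \<and> component_weights G A = add_mset k M} * count (add_mset k M) k"
proof -
  let ?A = "{A. A \<subseteq> E \<and> component_weights G A = add_mset k M}"
  let ?K = "\<lambda>A. {K \<in> component_sets V A. wt G K = k}"
  have "wt G K = k" if "component_weights G A = add_mset (wt G K) M" for A K
    using sum_component_weights[of A] that assms by simp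
  then have eq: "cut_pairs G M = Sigma ?A ?K" by (auto simp: cut_pairs_def)
  have K: "card (?K A) = count (add_mset k M) k" if "A \<in> ?A" for A
  proof -
    have "count (component_weights G A) k = card (?K A)"
      using finite_component_sets[OF finite_verts, of A]
      by (simp add: component_weights_def count_image_mset Int_def vimage_def conj_commute)
    then show ?thesis using that by simp
  qed
  have fin: "finite ?A" using finite_edges by (rule_tac finite_subset[of _ "Pow E"]) auto
  have "card (Sigma ?A ?K) = (\<Sum>A\<in>?A. card (?K A))"
    using fin finite_component_sets[OF finite_verts] by (intro card_SigmaI) auto
  also have "\<dots> = (\<Sum>A\<in>?A. count (add_mset k M) k)" using K by (rule sum.cong[OF refl])
  finally show ?thesis unfolding eq by simp
qed

end

lemma W_poly_eq_imp:
  assumes "tree G" "tree H" "W_poly G = W_poly H"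
  shows "card {A. A \<subseteq> edges G \<and> component_weights G A = P} =
    card {A. A \<subseteq> edges H \<and> component_weights H A = P}"
  using tree.lookup_W_poly[OF assms(1), of P] tree.lookup_W_poly[OF assms(2), of P] assms(3)
  by simp

text \<open>The indices in every occurring monomial add up to the total weight, and coefficients
  count edge sets, so nothing cancels.\<close>

lemma W_poly_eq_imp_total_weight_eq:
  assumes "tree G" "tree H" "W_poly G = W_poly H"
  shows "total_weight G = total_weight H"
proof -
  interpret G: tree G by fact
  interpret H: tree H by fact
  let ?P = "component_weights G (edges G)"
  have "finite {A. A \<subseteq> edges G \<and> component_weights G A = ?P}"
    using G.finite_edges by (rule_tac finite_subset[of _ "Pow (edges G)"]) auto
  then have "card {A. A \<subseteq> edges G \<and> component_weights G A = ?P} \<noteq> 0" by auto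
  then have "card {A. A \<subseteq> edges H \<and> component_weights H A = ?P} \<noteq> 0"
    using W_poly_eq_imp[OF assms] by metis
  then obtain A where "component_weights H A = ?P" by (metis (mono_tags, lifting) card.empty empty_Collect_eq)
  then show ?thesis using G.sum_component_weights H.sum_component_weights by metis
qed

lemma W_poly_eq_imp_card_branch_families_eq:
  assumes "tree G" "tree H" "W_poly G = W_poly H" and M: "2 * sum_mset M \<le> total_weight G"
  shows "card (branch_families G M) = card (branch_families H M)"
proof -
  have t: "total_weight G = total_weight H" using assms by (metis W_poly_eq_imp_total_weight_eq)
  have k: "(total_weight G - sum_mset M) + sum_mset M = total_weight G" using M by simp
  have "card (cut_pairs G M) = card (cut_pairs H M)"
    using tree.card_cut_pairs[OF assms(1) k] tree.card_cut_pairs[OF assms(2) k[unfolded t]]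
      W_poly_eq_imp[OF assms(1-3)] t by simp
  then show ?thesis
    using tree.bij_betw_branch_families_cut_pairs[OF assms(1) M]
      tree.bij_betw_branch_families_cut_pairs[OF assms(2) M[unfolded t]]
    by (simp add: bij_betw_same_card[of _ "branch_families _ M"])
qed

section \<open>Isomorphisms of laminar families\<close>

text \<open>The labels are parameters because two kinds are used: vertex weights control the
  matching of branches, while their sums are enough to compute parts and to rebuild the
  tree.\<close>

definition family_iso ::
  "('a set \<Rightarrow> 't) \<Rightarrow> ('b set \<Rightarrow> 't) \<Rightarrow> ('a set \<Rightarrow> 'b set) \<Rightarrow> 'a set set \<Rightarrow> 'b set set \<Rightarrow> bool" where
  "family_iso t t' \<phi> \<A> \<B> \<longleftrightarrow> bij_betw \<phi> \<A> \<B> \<and>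
     (\<forall>R\<in>\<A>. \<forall>S\<in>\<A>. R \<subseteq> S \<longleftrightarrow> \<phi> R \<subseteq> \<phi> S) \<and> (\<forall>S\<in>\<A>. t' (\<phi> S) = t S)"

lemma family_iso_image:
  "family_iso t t' \<phi> \<A> \<B> \<Longrightarrow> \<U> \<subseteq> \<A> \<Longrightarrow> family_iso t t' \<phi> \<U> (\<phi> ` \<U>)"
  unfolding family_iso_def by (blast intro: bij_betw_subset)

text \<open>The weight of a member is the sum over the parts of all members below it, itself
  included. Solving this recursively expresses the weight of a part by the order and the labels
  alone.\<close>

lemma sum_part_family_iso:
  assumes iso: "family_iso (sum f) (sum f') \<phi> \<U> \<W>"
    and fin: "finite \<U>" "finite \<W>" "\<And>S. S \<in> \<U> \<Longrightarrow> finite S" "\<And>S. S \<in> \<W> \<Longrightarrow> finite S"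
    and lam: "laminar \<U>" "laminar \<W>"
    and S: "S \<in> \<U>"
  shows "sum f' (part \<W> (\<phi> S)) = sum (f :: _ \<Rightarrow> nat) (part \<U> S)"
  using S
proof (induction "card S" arbitrary: S rule: less_induct)
  case less
  let ?D = "{R \<in> \<U>. R \<subseteq> S}"
  have bij: "bij_betw \<phi> \<U> \<W>" and ord: "\<And>R Q. R \<in> \<U> \<Longrightarrow> Q \<in> \<U> \<Longrightarrow> R \<subseteq> Q \<longleftrightarrow> \<phi> R \<subseteq> \<phi> Q"
    and tS: "sum f' (\<phi> S) = sum f S" using iso less.prems unfolding family_iso_def by blast+
  have im: "\<phi> ` \<U> = \<W>" and inj: "inj_on \<phi> \<U>" using bij by (auto simp: bij_betw_def)
  then have D: "{R \<in> \<W>. R \<subseteq> \<phi> S} = \<phi> ` ?D" using ord less.prems by blast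
  have injD: "inj_on \<phi> ?D" using inj by (rule inj_on_subset) blast
  have finD: "finite ?D" using fin by simp
  have SD: "S \<in> ?D" using less.prems by simp
  have "(\<Sum>R\<in>?D. sum f' (part \<W> (\<phi> R))) = sum f' (\<phi> S)"
    using sum_parts_below[OF fin(2,4) lam(2), of "\<phi> S" f'] less.prems im
    unfolding D by (auto simp: sum.reindex[OF injD])
  also have "\<dots> = (\<Sum>R\<in>?D. sum f (part \<U> R))"
    using sum_parts_below[OF fin(1,3) lam(1) less.prems, of f] tS by simp
  finally have eq: "(\<Sum>R\<in>?D. sum f' (part \<W> (\<phi> R))) = (\<Sum>R\<in>?D. sum f (part \<U> R))" .
  have "(\<Sum>R\<in>?D - {S}. sum f' (part \<W> (\<phi> R))) = (\<Sum>R\<in>?D - {S}. sum f (part \<U> R))"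
  proof (rule sum.cong[OF refl])
    fix R assume R: "R \<in> ?D - {S}"
    then have "card R < card S" using fin(3)[OF less.prems] by (intro psubset_card_mono) auto
    then show "sum f' (part \<W> (\<phi> R)) = sum f (part \<U> R)" using less.hyps R by blast
  qed
  then show ?case using eq by (simp add: sum.remove[OF finD SD])
qed

text \<open>Greedy matching: a member \<open>S\<close> of largest cardinality is paired with some
  \<open>S'\<close> of the same label, which is also largest because labels determine cardinalities.
  Everything below the two is matched by the last hypothesis and removed. By laminarity the
  remaining members are disjoint from \<open>S\<close> or \<open>S'\<close>, and their label counts
  still agree.\<close>

lemma family_isoI:
  fixes \<A> :: "'a set set" and \<B> :: "'b set set"
  assumes "finite \<A>" "finite \<B>" "laminar \<A>" "laminar \<B>"
    and "\<And>S. S \<in> \<A> \<Longrightarrow> finite S \<and> S \<noteq> {}" "\<And>S. S \<in> \<B> \<Longrightarrow> finite S \<and> S \<noteq> {}"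
    and "\<And>x. card {S \<in> \<A>. t S = x} = card {S \<in> \<B>. t' S = x}"
    and "\<And>S. S \<in> \<A> \<Longrightarrow> card S = c (t S)" "\<And>S. S \<in> \<B> \<Longrightarrow> card S = c (t' S)"
    and "\<And>S R. S \<in> \<A> \<Longrightarrow> R \<in> \<B> \<Longrightarrow> t S = t' R \<Longrightarrow>
      \<exists>\<phi>. family_iso t t' \<phi> {Q \<in> \<A>. Q \<subseteq> S} {Q \<in> \<B>. Q \<subseteq> R}"
  shows "\<exists>\<phi>. family_iso t t' \<phi> \<A> \<B>"
  using assms
proof (induction "card \<A>" arbitrary: \<A> \<B> rule: less_induct)
  case less
  note fin = less.prems(1,2) and lam = less.prems(3,4) and mem = less.prems(5,6)
    and cnt = less.prems(7) and c = less.prems(8,9) and down = less.prems(10)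
  have ex: "\<exists>R\<in>\<B>. t' R = t S" if "S \<in> \<A>" for S
  proof -
    have "card {Q \<in> \<A>. t Q = t S} \<noteq> 0" using that fin by auto
    then have "card {Q \<in> \<B>. t' Q = t S} \<noteq> 0" using cnt by simp
    then have "{Q \<in> \<B>. t' Q = t S} \<noteq> {}" by (auto simp: card_eq_0_iff)
    then show ?thesis by blast
  qed
  have ex': "\<exists>R\<in>\<A>. t R = t' S" if "S \<in> \<B>" for S
  proof -
    have "card {Q \<in> \<B>. t' Q = t' S} \<noteq> 0" using that fin by auto
    then have "card {Q \<in> \<A>. t Q = t' S} \<noteq> 0" using cnt by simp
    then have "{Q \<in> \<A>. t Q = t' S} \<noteq> {}" by (auto simp: card_eq_0_iff)
    then show ?thesis by blast
  qed
  show ?case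
  proof (cases "\<A> = {}")
    case True
    then have "\<B> = {}" using ex' by blast
    then show ?thesis using True by (auto simp: family_iso_def bij_betw_def)
  next
    case False
    have "Max (card ` \<A>) \<in> card ` \<A>" using False fin(1) by (intro Max_in) auto
    then obtain S where S: "S \<in> \<A>" "card S = Max (card ` \<A>)" by force
    have Smax: "card R \<le> card S" if "R \<in> \<A>" for R using S(2) that fin(1) by simp
    obtain S' where S': "S' \<in> \<B>" "t' S' = t S" using ex S by blast
    have S'max: "card R \<le> card S'" if "R \<in> \<B>" for R
      using ex'[OF that] c S(1) Smax S' that by metis
    obtain \<phi> where \<phi>: "family_iso t t' \<phi> {Q \<in> \<A>. Q \<subseteq> S} {Q \<in> \<B>. Q \<subseteq> S'}"
      using down[OF S(1) S'(1)] S'(2) by auto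
    let ?D = "{Q \<in> \<A>. Q \<subseteq> S}" and ?D' = "{Q \<in> \<B>. Q \<subseteq> S'}"
    let ?A = "\<A> - ?D" and ?B = "\<B> - ?D'"
    have dA: "Q \<inter> S = {}" if "Q \<in> ?A" for Q
    proof -
      have "\<not> S \<subseteq> Q" using that Smax[of Q] mem(1)[of Q] card_seteq[of Q S] by auto
      then show ?thesis using lam(1) that S(1) unfolding laminar_def by blast
    qed
    have dB: "Q \<inter> S' = {}" if "Q \<in> ?B" for Q
    proof -
      have "\<not> S' \<subseteq> Q" using that S'max[of Q] mem(2)[of Q] card_seteq[of Q S'] by auto
      then show ?thesis using lam(2) that S'(1) unfolding laminar_def by blast
    qed
    have cD: "card {Q \<in> ?D. t Q = x} = card {Q \<in> ?D'. t' Q = x}" for x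
    proof -
      have bij: "bij_betw \<phi> ?D ?D'" and t: "\<And>Q. Q \<in> ?D \<Longrightarrow> t' (\<phi> Q) = t Q"
        using \<phi> unfolding family_iso_def by blast+
      have "\<phi> ` {Q \<in> ?D. t Q = x} = {Q \<in> \<phi> ` ?D. t' Q = x}" using t by auto
      also have "\<phi> ` ?D = ?D'" using bij by (simp add: bij_betw_def)
      finally have "bij_betw \<phi> {Q \<in> ?D. t Q = x} {Q \<in> ?D'. t' Q = x}"
        using bij by (elim bij_betw_subset) auto
      then show ?thesis by (rule bij_betw_same_card)
    qed
    have "\<exists>\<psi>. family_iso t t' \<psi> ?A ?B"
    proof (rule less.hyps)
      show "card ?A < card \<A>" using S(1) fin by (intro psubset_card_mono) auto
      show "finite ?A" "finite ?B" using fin by auto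
      show "laminar ?A" "laminar ?B" using lam by (auto intro: laminar_subset)
      show "\<And>S. S \<in> ?A \<Longrightarrow> finite S \<and> S \<noteq> {}" "\<And>S. S \<in> ?B \<Longrightarrow> finite S \<and> S \<noteq> {}"
        using mem by auto
      show "\<And>S. S \<in> ?A \<Longrightarrow> card S = c (t S)" "\<And>S. S \<in> ?B \<Longrightarrow> card S = c (t' S)"
        using c by auto
      show "card {Q \<in> ?A. t Q = x} = card {Q \<in> ?B. t' Q = x}" for x
      proof -
        have "{Q \<in> ?A. t Q = x} = {Q \<in> \<A>. t Q = x} - {Q \<in> ?D. t Q = x}" 
          "{Q \<in> ?B. t' Q = x} = {Q \<in> \<B>. t' Q = x} - {Q \<in> ?D'. t' Q = x}" by auto
        then show ?thesis using cnt cD fin by (simp add: card_Diff_subset subset_iff)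
      qed
      show "\<exists>\<psi>. family_iso t t' \<psi> {Q \<in> ?A. Q \<subseteq> R} {Q \<in> ?B. Q \<subseteq> R'}"
        if R: "R \<in> ?A" "R' \<in> ?B" "t R = t' R'" for R R'
      proof -
        have "{Q \<in> ?A. Q \<subseteq> R} = {Q \<in> \<A>. Q \<subseteq> R}" using dA[OF R(1)] mem(1) by blast
        moreover have "{Q \<in> ?B. Q \<subseteq> R'} = {Q \<in> \<B>. Q \<subseteq> R'}" using dB[OF R(2)] mem(2) by blast
        ultimately show ?thesis using down R by auto
      qed
    qed
    then obtain \<psi> where \<psi>: "family_iso t t' \<psi> ?A ?B" by blast
    let ?g = "\<lambda>Q. if Q \<subseteq> S then \<phi> Q else \<psi> Q"
    have 1: "\<phi> Q \<in> ?D'" if "Q \<in> ?D" for Q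
      using \<phi> that unfolding family_iso_def by (meson bij_betwE)
    have 2: "\<psi> Q \<in> ?B" if "Q \<in> ?A" for Q
      using \<psi> that unfolding family_iso_def by (meson bij_betwE)
    \<comment> \<open>Mixed pairs are incomparable on both sides: removed members lie inside the
      largest one, remaining members are disjoint from it, and all are nonempty.\<close>
    have ord: "Q \<subseteq> R \<longleftrightarrow> ?g Q \<subseteq> ?g R" if QR: "Q \<in> \<A>" "R \<in> \<A>" for Q R
    proof -
      consider "Q \<in> ?D" "R \<in> ?D" | "Q \<in> ?A" "R \<in> ?A" | "Q \<in> ?D" "R \<in> ?A" | "Q \<in> ?A" "R \<in> ?D"
        using QR by blast
      then show ?thesis
      proof cases
        case 1
        then have "Q \<subseteq> R \<longleftrightarrow> \<phi> Q \<subseteq> \<phi> R" using \<phi> unfolding family_iso_def by blast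
        then show ?thesis using 1 by simp
      next
        case 2
        then have "Q \<subseteq> R \<longleftrightarrow> \<psi> Q \<subseteq> \<psi> R" using \<psi> unfolding family_iso_def by blast
        moreover have "\<not> Q \<subseteq> S" "\<not> R \<subseteq> S" using 2 by auto
        ultimately show ?thesis by simp
      next
        case 3
        then have "\<not> Q \<subseteq> R" using dA[of R] mem(1)[of Q] by blast
        moreover have "\<not> \<phi> Q \<subseteq> \<psi> R" using dB[OF 2[OF 3(2)]] 1[OF 3(1)] mem(2) by blast
        ultimately show ?thesis using 3 by simp
      next
        case 4
        then have "\<not> Q \<subseteq> R" by blast
        moreover have "\<not> \<psi> Q \<subseteq> \<phi> R" using dB[OF 2[OF 4(1)]] 1[OF 4(2)] mem(2) 2[OF 4(1)] by blast
        ultimately show ?thesis using 4 by simp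
      qed
    qed
    have "bij_betw ?g (?D \<union> ?A) (?D' \<union> ?B)"
    proof (rule bij_betw_combine)
      have b: "bij_betw \<phi> ?D ?D'" using \<phi> unfolding family_iso_def by (rule conjunct1)
      have "bij_betw ?g ?D ?D' = bij_betw \<phi> ?D ?D'" by (rule bij_betw_cong) simp
      then show "bij_betw ?g ?D ?D'" using b by (rule iffD2)
      have b: "bij_betw \<psi> ?A ?B" using \<psi> unfolding family_iso_def by (rule conjunct1)
      have "bij_betw ?g ?A ?B = bij_betw \<psi> ?A ?B" by (rule bij_betw_cong) auto
      then show "bij_betw ?g ?A ?B" using b by (rule iffD2)
    qed blast
    moreover have "?D \<union> ?A = \<A>" "?D' \<union> ?B = \<B>" by blast+
    ultimately have "bij_betw ?g \<A> \<B>" by simp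
    moreover have "t' (?g Q) = t Q" if "Q \<in> \<A>" for Q
    proof (cases "Q \<subseteq> S")
      case True
      then have "Q \<in> ?D" using that by simp
      then have "t' (\<phi> Q) = t Q" using \<phi> unfolding family_iso_def by blast
      then show ?thesis using True by simp
    next
      case False
      then have "Q \<in> ?A" using that by simp
      then have "t' (\<psi> Q) = t Q" using \<psi> unfolding family_iso_def by blast
      then show ?thesis using False by simp
    qed
    ultimately have "family_iso t t' ?g \<A> \<B>" using ord unfolding family_iso_def by blast
    then show ?thesis by blast
  qed
qed

section \<open>Counting light branches\<close>

abbreviation vertex_weights :: "'a wgraph \<Rightarrow> 'a set \<Rightarrow> nat multiset" where
  "vertex_weights G S \<equiv> image_mset (weight G) (mset_set S)"

text \<open>This is r-isomorphism for branches: the root is recovered as the only vertex of the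
  branch that lies on its cut edge.\<close>

definition branch_iso :: "('a \<Rightarrow> 'b) \<Rightarrow> 'a wgraph \<Rightarrow> 'a set \<Rightarrow> 'b wgraph \<Rightarrow> 'b set \<Rightarrow> bool" where
  "branch_iso f G S H R \<longleftrightarrow> bij_betw f S R \<and>
     (\<forall>u\<in>S. \<forall>v\<in>S. {u, v} \<in> edges G \<longleftrightarrow> {f u, f v} \<in> edges H) \<and>
     (\<forall>u\<in>S. weight H (f u) = weight G u) \<and>
     (\<forall>u\<in>S. u \<in> cut_edge G S \<longleftrightarrow> f u \<in> cut_edge H R)"

lemma branch_iso_inv:
  assumes "branch_iso f G S H R"
  shows "branch_iso (inv_into S f) H R G S"
proof -
  have bij: "bij_betw f S R" using assms by (simp add: branch_iso_def)
  let ?g = "inv_into S f"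
  have g: "?g u \<in> S" "f (?g u) = u" if "u \<in> R" for u
    using bij that by (auto simp: bij_betw_def inv_into_into f_inv_into_f)
  show ?thesis
    using assms g bij_betw_inv_into[OF bij] unfolding branch_iso_def by metis
qed

lemma branch_iso_light:
  assumes "tree G" "tree H" and tot: "total_weight G = total_weight H"
    and iso: "branch_iso f G S H R" and S: "S \<in> light_branches G" and R: "R \<in> light_branches H"
    and Q: "Q \<in> light_branches G" "Q \<subseteq> S"
  shows "f ` Q \<in> light_branches H" "f ` Q \<subseteq> R" "vertex_weights H (f ` Q) = vertex_weights G Q"
proof -
  interpret G: tree G by fact
  interpret H: tree H by fact
  have bS: "branch G S" and bR: "branch H R" and bQ: "branch G Q"
    using S R Q G.light_branchD H.light_branchD by blast+
  have bij: "bij_betw f S R" and ed: "\<And>u v. u \<in> S \<Longrightarrow> v \<in> S \<Longrightarrow> {u, v} \<in> edges G \<longleftrightarrow> {f u, f v} \<in> edges H"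
    and w: "\<And>u. u \<in> S \<Longrightarrow> weight H (f u) = weight G u"
    and root: "\<And>u. u \<in> S \<Longrightarrow> u \<in> cut_edge G S \<longleftrightarrow> f u \<in> cut_edge H R"
    using iso unfolding branch_iso_def by blast+
  have inj: "inj_on f S" and im: "f ` S = R" using bij by (auto simp: bij_betw_def)
  have injQ: "inj_on f Q" using inj Q(2) by (rule inj_on_subset)
  show sub: "f ` Q \<subseteq> R" using im Q(2) by blast
  have "mset_set (f ` Q) = image_mset f (mset_set Q)" using injQ by (simp add: image_mset_mset_set)
  then show vw: "vertex_weights H (f ` Q) = vertex_weights G Q"
    using w Q(2) G.finite_branch[OF bQ]
    by (auto simp: image_mset.compositionality intro!: image_mset_cong)
  have "branch H (f ` Q)"
  proof (cases "Q = S")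
    case True
    then show ?thesis using im bR by simp
  next
    case False
    obtain r p where rp: "cut_edge G S = {r, p}" "r \<in> S" "p \<in> verts G" "p \<notin> S"
      using bS by (rule G.branchE)
    have neq: "cut_edge G Q \<noteq> cut_edge G S"
      using G.cut_edge_eq[OF bQ bS] False Q(2) G.branch_nonempty[OF bQ] by blast
    have rQ: "r \<notin> Q"
    proof
      assume "r \<in> Q"
      then have "cut_edge G Q = {r, p}"
        using rp Q(2) G.cut_edge_in[OF bS] by (intro G.branch_crosses[OF bQ]) auto
      then show False using neq rp(1) by simp
    qed
    obtain a b where ab: "cut_edge G Q = {a, b}" "a \<in> Q" "b \<in> verts G" "b \<notin> Q"
      using bQ by (rule G.branchE)
    have abE: "{a, b} \<in> edges G" using G.cut_edge_in[OF bQ] ab(1) by simp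
    have bS': "b \<in> S"
    proof (rule ccontr)
      assume "b \<notin> S"
      then have "cut_edge G S = {a, b}" using G.branch_crosses[OF bS abE] ab(2) Q(2) by blast
      then show False using neq ab(1) by simp
    qed
    have notin: "f v \<notin> f ` Q" if "v \<in> S" "v \<notin> Q" for v
      using that inj Q(2) by (auto dest: inj_onD)
    have "{f a, f b} \<in> crossing H (f ` Q)"
      using ed[of a b] abE ab bS' Q(2) notin[of b] by (auto simp: crossing_doubleton)
    moreover have "e = {f a, f b}" if e: "e \<in> crossing H (f ` Q)" for e
    proof -
      have eE: "e \<in> edges H" using e by (simp add: crossing_def)
      then obtain x0 y0 where "e = {x0, y0}" by (meson H.edgeE)
      then obtain x y where xy: "e = {x, y}" "x \<in> f ` Q" "y \<notin> f ` Q"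
        using e crossing_doubleton[of x0 y0 H "f ` Q"] by (metis insert_commute)
      then obtain u where u: "x = f u" "u \<in> Q" by blast
      have "y \<in> R"
      proof (rule ccontr)
        assume "y \<notin> R"
        then have "cut_edge H R = {x, y}" using H.branch_crosses[OF bR, of x y] xy eE sub by blast
        then have "u \<in> cut_edge G S" using root[of u] u Q(2) by auto
        then have "u = r" using rp u(2) Q(2) by auto
        then show False using u(2) rQ by simp
      qed
      then obtain v where v: "y = f v" "v \<in> S" using im by blast
      have "v \<notin> Q" using xy(3) v(1) by blast
      moreover have "{u, v} \<in> edges G" using ed[of u v] eE xy(1) u v Q(2) by auto
      ultimately have "cut_edge G Q = {u, v}" using G.branch_crosses[OF bQ] u(2) by blast
      then have "u = a" "v = b" using ab u(2) \<open>v \<notin> Q\<close> by (auto simp: doubleton_eq_iff)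
      then show ?thesis using xy(1) u(1) v(1) by simp
    qed
    ultimately have "crossing H (f ` Q) = {{f a, f b}}" by blast
    then show ?thesis using sub H.branch_subset[OF bR] H.branchI by (meson subset_trans)
  qed
  moreover have "wt H (f ` Q) = wt G Q"
    using vw by (simp add: sum_unfold_sum_mset)
  ultimately show "f ` Q \<in> light_branches H"
    using G.light_branchD(2)[OF Q(1)] tot by (simp add: light_branches_def)
qed

lemma family_iso_below:
  assumes "tree G" "tree H" and tot: "total_weight G = total_weight H"
    and iso: "branch_iso f G S H R" and S: "S \<in> light_branches G" and R: "R \<in> light_branches H"
  shows "family_iso (vertex_weights G) (vertex_weights H) ((`) f)
    {Q \<in> light_branches G. Q \<subseteq> S} {Q \<in> light_branches H. Q \<subseteq> R}"
proof -
  note fwd = branch_iso_light[OF assms]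
  note bwd = branch_iso_light[OF assms(2,1) tot[symmetric] branch_iso_inv[OF iso] R S]
  have bij: "bij_betw f S R" using iso by (simp add: branch_iso_def)
  then have inj: "inj_on f S" and im: "f ` S = R" by (auto simp: bij_betw_def)
  have b: "bij_betw ((`) f) {Q \<in> light_branches G. Q \<subseteq> S} {Q \<in> light_branches H. Q \<subseteq> R}"
  proof (rule bij_betw_byWitness[where f' = "(`) (inv_into S f)"])
    show "\<forall>Q\<in>{Q \<in> light_branches G. Q \<subseteq> S}. inv_into S f ` f ` Q = Q"
      using inj by (auto simp: inv_into_image_cancel)
    show "\<forall>Q\<in>{Q \<in> light_branches H. Q \<subseteq> R}. f ` inv_into S f ` Q = Q"
      using im by (auto simp: image_inv_into_cancel)
    show "(`) f ` {Q \<in> light_branches G. Q \<subseteq> S} \<subseteq> {Q \<in> light_branches H. Q \<subseteq> R}"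
      by (rule image_subsetI) (use fwd(1,2) in simp)
    show "(`) (inv_into S f) ` {Q \<in> light_branches H. Q \<subseteq> R} \<subseteq> {Q \<in> light_branches G. Q \<subseteq> S}"
      by (rule image_subsetI) (use bwd(1,2) in simp)
  qed
  have "f ` Q \<subseteq> f ` Q' \<longleftrightarrow> Q \<subseteq> Q'" if "Q \<subseteq> S" "Q' \<subseteq> S" for Q Q'
    using that inj_on_image_mem_iff[OF inj _ that(2)] by blast
  then show ?thesis using b fwd(3) unfolding family_iso_def by simp
qed

section \<open>Families that cut a branch into single vertices\<close>

context tree
begin

lemma sum_vertex_weights: "sum_mset (vertex_weights G S) = wt G S"
  by (simp add: sum_unfold_sum_mset)

text \<open>The point is that \<open>V - S\<close> stays in one piece. A component disjoint from
  \<open>S\<close> can only be left by edges meeting \<open>S\<close>, hence only by the cut edge of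
  \<open>S\<close>, and a set with that boundary is \<open>S\<close> or
  \<open>V - S\<close>.\<close>

lemma singleton_components:
  assumes S: "branch G S"
  shows "component_sets V (E - {e \<in> E. e \<inter> S \<noteq> {}}) = insert (V - S) ((\<lambda>x. {x}) ` S)"
    (is "component_sets V ?A = ?P")
proof -
  have SV: "S \<subseteq> V" "S \<noteq> {}" "S \<noteq> V"
    using S branch_subset branch_nonempty branch_neq_verts by auto
  have finP: "finite ?P" using finite_branch[OF S] by simp
  have noS: "x \<notin> S" "y \<notin> S" if "{x, y} \<in> ?A" for x y using that by auto
  have "C \<in> ?P" if C: "C \<in> component_sets V ?A" for C
  proof (cases "C \<inter> S = {}")
    case False
    then obtain y where y: "y \<in> C" "y \<in> S" by blast
    have "z = y" if z: "z \<in> C" for z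
    proof -
      have "(y, z) \<in> reach V ?A"
        using C y(1) z in_quotient_imp_in_rel[OF reach_equiv, of C V ?A y z]
        unfolding component_sets_def by blast
      then have "z \<in> {y}"
      proof (rule reach_closed)
        fix a b assume ab: "{a, b} \<in> ?A" "a \<in> {y}"
        have "a \<notin> S" using ab(1) by (rule noS(1))
        then show "b \<in> {y}" using ab(2) y(2) by simp
      qed simp
      then show ?thesis by simp
    qed
    then have "C = {y}" using y(1) by blast
    then show ?thesis using y(2) by blast
  next
    case True
    have CV: "C \<subseteq> V" "C \<noteq> {}" "C \<noteq> V"
      using component_sets_subset[OF C] component_sets_nonempty[OF C] True SV by blast+
    have "e = cut_edge G S" if e: "e \<in> crossing G C" for e
    proof -
      have eE: "e \<in> E" using e by (simp add: crossing_def)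
      then obtain x0 y0 where "e = {x0, y0}" by (meson edgeE)
      then obtain x y where xy: "e = {x, y}" "x \<in> C" "y \<notin> C"
        using e crossing_doubleton[of x0 y0 G C] by (metis insert_commute)
      have yV: "y \<in> V" using edge_subset[OF eE] xy(1) by blast
      have "e \<notin> ?A" using component_sets_edge[OF C, of x y] xy yV by blast
      then have "e \<inter> S \<noteq> {}" using eE by blast
      moreover have "x \<notin> S" using True xy(2) by blast
      ultimately have "y \<in> S" using xy(1) by auto
      then show ?thesis using branch_crosses[OF S, of y x] eE xy(1) \<open>x \<notin> S\<close> by (simp add: insert_commute)
    qed
    then have "crossing G C \<subseteq> {cut_edge G S}" by blast
    then have "crossing G C = crossing G S"
      using crossing_nonempty[OF CV] crossing_branch[OF S] by (simp add: subset_singleton_iff)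
    then have "C = S \<or> C = V - S" using CV(1) SV(1) by (intro crossing_eq) auto
    then show ?thesis using True SV(2) by blast
  qed
  then have le: "card (component_sets V ?A) \<le> card ?P" by (intro card_mono finP) blast
  show ?thesis
  proof (rule component_sets_eqI[OF finite_verts _ _ _ _ le])
    show "\<Union>?P = V" using SV(1) by auto
    show "{} \<notin> ?P" using SV by auto
    show "C = D \<or> C \<inter> D = {}" if "C \<in> ?P" "D \<in> ?P" for C D using that by auto
    show "y \<in> C" if C: "C \<in> ?P" "{x, y} \<in> ?A" "x \<in> C" for C x y
    proof -
      have "y \<in> V" using edge_subset C(2) by blast
      then show ?thesis using C(1,3) noS[OF C(2)] by blast
    qed
  qed
qed

lemma branch_familiesD:
  assumes "2 * sum_mset M \<le> total_weight G" "\<U> \<in> branch_families G M"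
  shows "\<And>S. S \<in> \<U> \<Longrightarrow> branch G S" "laminar \<U>" "\<Union>\<U> \<subseteq> V" "\<Union>\<U> \<noteq> V"
    "wt G (\<Union>\<U>) = sum_mset M" "size M = card \<U>" "finite \<U>"
proof -
  have \<U>: "\<U> \<subseteq> light_branches G" "part_weights G \<U> = M"
    using assms(2) by (auto simp: branch_families_def)
  then show br: "\<And>S. S \<in> \<U> \<Longrightarrow> branch G S" using light_branchD by blast
  show lam: "laminar \<U>" using laminar_subset[OF laminar_light \<U>(1)] .
  show wU: "wt G (\<Union>\<U>) = sum_mset M" using sum_part_weights[OF br lam] \<U>(2) by simp
  have "0 < wt G V" using wt_pos[of V] verts_nonempty by simp
  then show "\<Union>\<U> \<noteq> V" using wU assms(1) by (auto simp: total_weight_def)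
  show "\<Union>\<U> \<subseteq> V" using br branch_subset by blast
  show "size M = card \<U>" using \<U>(2) by (auto simp: part_weights_def)
  show "finite \<U>" using br by (rule finite_branches)
qed

text \<open>A family that is not built from the smaller branches cuts a single branch into its vertices.\<close>

lemma card_branch_families:
  assumes M: "2 * sum_mset M \<le> total_weight G"
  defines "\<A> \<equiv> {S \<in> light_branches G. wt G S < sum_mset M \<or> wt G S = sum_mset M \<and> size M < card S}"
  shows "card (branch_families G M) = card {\<U>. \<U> \<subseteq> \<A> \<and> part_weights G \<U> = M} +
    card {S \<in> light_branches G. vertex_weights G S = M}"
proof -
  let ?F = "branch_families G M"
  let ?X = "{\<U> \<in> ?F. \<not> \<U> \<subseteq> \<A>}"
  let ?Y = "{S \<in> light_branches G. vertex_weights G S = M}"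
  note D = branch_familiesD[OF M]
  \<comment> \<open>A member outside \<open>\<A>\<close> has the weight of the whole union, hence
    equals it, and has at most \<open>card \<U>\<close> vertices. Since it splits into
    \<open>card \<U>\<close> nonempty parts, each part is a single vertex.\<close>
  have top: "\<Union>\<U> \<in> \<U> \<and> \<Union>\<U> \<in> ?Y \<and> (\<forall>R\<in>\<U>. \<exists>x. part \<U> R = {x})" if U: "\<U> \<in> ?X" for \<U>
  proof -
    have UF: "\<U> \<in> ?F" and light: "\<U> \<subseteq> light_branches G" and pw: "part_weights G \<U> = M"
      using U by (auto simp: branch_families_def)
    note D = D[OF UF]
    obtain S where S: "S \<in> \<U>" "S \<notin> \<A>" using U by blast
    have le: "wt G S \<le> sum_mset M" using wt_mono[of S "\<Union>\<U>"] S(1) D(3,5) by auto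
    then have wS: "wt G S = sum_mset M" and cS: "card S \<le> card \<U>"
      using S light D(6) unfolding \<A>_def by auto
    have SU: "\<Union>\<U> = S" using wt_strict_mono[of S "\<Union>\<U>"] wS D(3,5) S(1) by (metis Union_upper less_irrefl psubsetI)
    have fin: "\<And>R. R \<in> \<U> \<Longrightarrow> finite R" using D(1) finite_branch by blast
    have pos: "1 \<le> card (part \<U> R)" if "R \<in> \<U>" for R
      using part_nonempty[OF D(1) inj_cut_edge[OF D(1,4)] that] fin[OF that] part_subset[of \<U> R]
      by (simp add: Suc_le_eq card_gt_0_iff finite_subset)
    have "(\<Sum>R\<in>\<U>. card (part \<U> R)) = card S"
      using sum_parts[OF D(7) fin D(2), of \<U> "\<lambda>_. 1 :: nat"] SU by simp
    have one: "card (part \<U> R) = 1" if R: "R \<in> \<U>" for R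
    proof (rule ccontr)
      assume "card (part \<U> R) \<noteq> 1"
      then have "(\<Sum>R\<in>\<U>. 1) < (\<Sum>R\<in>\<U>. card (part \<U> R))"
        using pos pos[OF R] D(7) by (intro sum_strict_mono_ex1 bexI[OF _ R]) auto
      then show False using cS \<open>(\<Sum>R\<in>\<U>. card (part \<U> R)) = card S\<close> by simp
    qed
    then have "\<forall>R\<in>\<U>. \<exists>x. part \<U> R = {x}" by (simp add: card_1_singleton_iff)
    then obtain x where x: "\<And>R. R \<in> \<U> \<Longrightarrow> part \<U> R = {x R}" by metis
    have inj: "inj_on x \<U>"
      using inj_part[OF D(1) inj_cut_edge[OF D(1,4)] D(2)] x by (auto simp: inj_on_def)
    have "S = x ` \<U>"
    proof -
      have "\<Union>(part \<U> ` \<U>) = S" using Union_part[of \<U> \<U>] D(7) SU by simp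
      moreover have "part \<U> ` \<U> = (\<lambda>R. {x R}) ` \<U>" using x by (rule image_cong[OF refl])
      ultimately show ?thesis by auto
    qed
    then have "vertex_weights G S = image_mset (\<lambda>R. weight G (x R)) (mset_set \<U>)"
      using inj by (simp add: image_mset.compositionality o_def flip: image_mset_mset_set)
    also have "\<dots> = part_weights G \<U>"
      unfolding part_weights_def using x D(7) by (intro image_mset_cong) auto
    finally have "vertex_weights G S = M" using pw by simp
    then show ?thesis using SU S(1) light x by auto
  qed
  \<comment> \<open>As the parts are single vertices, every edge meeting the union has been removed.
    The removed edges, and with them the family, are thus determined by the union.\<close>
  have cuts: "cut_edge G ` \<U> = {e \<in> E. e \<inter> \<Union>\<U> \<noteq> {}}" if U: "\<U> \<in> ?X" for \<U>
  proof
    have UF: "\<U> \<in> ?F" using U by blast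
    note D = D[OF UF]
    show "cut_edge G ` \<U> \<subseteq> {e \<in> E. e \<inter> \<Union>\<U> \<noteq> {}}"
    proof
      fix e assume "e \<in> cut_edge G ` \<U>"
      then obtain R where R: "R \<in> \<U>" "e = cut_edge G R" by blast
      obtain r p where "cut_edge G R = {r, p}" "r \<in> R" "p \<in> V" "p \<notin> R"
        using D(1)[OF R(1)] by (rule branchE)
      then show "e \<in> {e \<in> E. e \<inter> \<Union>\<U> \<noteq> {}}" using R cut_edge_in[OF D(1)[OF R(1)]] by auto
    qed
    show "{e \<in> E. e \<inter> \<Union>\<U> \<noteq> {}} \<subseteq> cut_edge G ` \<U>"
    proof
      fix e assume "e \<in> {e \<in> E. e \<inter> \<Union>\<U> \<noteq> {}}"
      then obtain x where x: "e \<in> E" "x \<in> e" "x \<in> \<Union>\<U>" by blast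
      obtain a b where "e = {a, b}" "a \<noteq> b" "a \<in> V" "b \<in> V" using x(1) by (rule edgeE)
      then obtain y where y: "e = {x, y}" "x \<noteq> y" "y \<in> V" using x(2) by blast
      have "x \<in> \<Union>(part \<U> ` \<U>)" using Union_part[of \<U> \<U>] D(7) x(3) by auto
      then obtain R where R: "R \<in> \<U>" "part \<U> R = {x}" using top[OF U] by fastforce
      show "e \<in> cut_edge G ` \<U>"
      proof (rule ccontr)
        assume "e \<notin> cut_edge G ` \<U>"
        then have "{x, y} \<in> E - cut_edge G ` \<U>" using x(1) y(1) by simp
        moreover have "part \<U> R \<in> component_sets V (E - cut_edge G ` \<U>)"
          using R(1) D(1,2,4) by (subst component_sets_branches(1)) auto
        then have "{x} \<in> component_sets V (E - cut_edge G ` \<U>)" using R(2) by simp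
        ultimately show False using component_sets_edge[of "{x}" V _ x y] y(2,3) by blast
      qed
    qed
  qed
  have "bij_betw Union ?X ?Y"
    unfolding bij_betw_def
  proof
    show "inj_on Union ?X"
    proof
      fix \<U> \<W> assume UW: "\<U> \<in> ?X" "\<W> \<in> ?X" "\<Union>\<U> = \<Union>\<W>"
      have "inj_on (\<lambda>\<U>. (E - cut_edge G ` \<U>, V - \<Union>\<U>)) ?F"
        using bij_betw_branch_families_cut_pairs[OF M] by (simp add: bij_betw_def)
      moreover have "(E - cut_edge G ` \<U>, V - \<Union>\<U>) = (E - cut_edge G ` \<W>, V - \<Union>\<W>)"
        unfolding cuts[OF UW(1)] cuts[OF UW(2)] UW(3) ..
      moreover have "\<U> \<in> ?F" "\<W> \<in> ?F" using UW by blast+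
      ultimately show "\<U> = \<W>" by (rule inj_onD)
    qed
    show "Union ` ?X = ?Y"
    proof
      show "Union ` ?X \<subseteq> ?Y" using top by blast
      show "?Y \<subseteq> Union ` ?X"
      proof
        fix S assume SY: "S \<in> ?Y"
        then have S: "S \<in> light_branches G" "vertex_weights G S = M" by auto
        have b: "branch G S" using S light_branchD by blast
        have SV: "S \<subseteq> V" "S \<noteq> {}" "S \<noteq> V" using b branch_subset branch_nonempty branch_neq_verts by auto
        \<comment> \<open>Conversely, deleting all edges that meet \<open>S\<close> marks
          \<open>V - S\<close> and leaves single vertices of weights \<open>M\<close>; the family is
          read off from this pair by the bijection.\<close>
        let ?A = "E - {e \<in> E. e \<inter> S \<noteq> {}}"
        have "V - S \<notin> (\<lambda>x. {x}) ` S" by auto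
        then have "component_weights G ?A = add_mset (wt G (V - S)) M"
          unfolding component_weights_def singleton_components[OF b] using finite_branch[OF b] S(2)
          by (simp add: image_mset.compositionality o_def flip: image_mset_mset_set)
        then have "(?A, V - S) \<in> cut_pairs G M"
          using singleton_components[OF b] by (simp add: cut_pairs_def)
        then have "(?A, V - S) \<in> (\<lambda>\<U>. (E - cut_edge G ` \<U>, V - \<Union>\<U>)) ` ?F"
          using bij_betw_branch_families_cut_pairs[OF M] by (simp only: bij_betw_def)
        then obtain \<U> where "\<U> \<in> ?F" "(?A, V - S) = (E - cut_edge G ` \<U>, V - \<Union>\<U>)"
          by (rule imageE)
        then have U: "\<U> \<in> ?F" "?A = E - cut_edge G ` \<U>" "V - S = V - \<Union>\<U>"
          by (simp_all only: prod.inject)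
        note D = D[OF U(1)]
        have "V - (V - S) = V - (V - \<Union>\<U>)" using U(3) by simp
        then have SU: "S = \<Union>\<U>" using SV(1) D(3) by (simp add: double_diff)
        \<comment> \<open>The family contains \<open>S\<close> itself: the cut edge of
          \<open>S\<close> is removed, and the member belonging to it lies in \<open>S\<close>, so
          it is not the complement of \<open>S\<close>.\<close>
        obtain r p where rp: "cut_edge G S = {r, p}" "r \<in> S" "p \<in> V" "p \<notin> S" using b by (rule branchE)
        then have "cut_edge G S \<notin> ?A" by auto
        then have "cut_edge G S \<in> cut_edge G ` \<U>" using U(2) cut_edge_in[OF b] by blast
        then obtain R where R: "R \<in> \<U>" "cut_edge G R = cut_edge G S" by force
        have "R \<subseteq> S" "R \<noteq> {}" using SU R(1) D(1) branch_nonempty by blast+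
        then have "R = S" using cut_edge_eq[OF D(1)[OF R(1)] b R(2)] by blast
        moreover have "S \<notin> \<A>" using S(2) sum_vertex_weights[of S] by (auto simp: \<A>_def)
        ultimately have "\<U> \<in> ?X" using U(1) R(1) by blast
        then show "S \<in> Union ` ?X" using SU by blast
      qed
    qed
  qed
  then have XY: "card ?X = card ?Y" by (rule bij_betw_same_card)
  have "finite ?F" using finite_light_branches by (rule_tac finite_subset[of _ "Pow (light_branches G)"]) (auto simp: branch_families_def)
  then have "card ?F = card (?F - ?X) + card ?X" by (simp add: card_Diff_subset card_mono)
  moreover have "?F - ?X = {\<U>. \<U> \<subseteq> \<A> \<and> part_weights G \<U> = M}"
    unfolding branch_families_def \<A>_def by auto
  ultimately show ?thesis using XY by simp
qed

end

text \<open>Taking images under \<open>\<phi>\<close> is a bijection of subfamilies. It keeps part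
  weights because these depend only on inclusions and on the weights of the members, which are the
  sums of their labels.\<close>

lemma card_families_family_iso:
  assumes "tree G" "tree H"
    and iso: "family_iso (vertex_weights G) (vertex_weights H) \<phi> \<A> \<B>"
    and A: "\<A> \<subseteq> light_branches G" and B: "\<B> \<subseteq> light_branches H"
  shows "card {\<U>. \<U> \<subseteq> \<A> \<and> part_weights G \<U> = M} = card {\<W>. \<W> \<subseteq> \<B> \<and> part_weights H \<W> = M}"
proof -
  interpret G: tree G by fact
  interpret H: tree H by fact
  have bij: "bij_betw \<phi> \<A> \<B>" using iso by (simp add: family_iso_def)
  then have im: "\<phi> ` \<A> = \<B>" and inj: "inj_on \<phi> \<A>" by (auto simp: bij_betw_def)
  have pw: "part_weights H (\<phi> ` \<U>) = part_weights G \<U>" if U: "\<U> \<subseteq> \<A>" for \<U>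
  proof -
    have UL: "\<U> \<subseteq> light_branches G" and WL: "\<phi> ` \<U> \<subseteq> light_branches H"
      using U A B im by blast+
    have fin: "finite \<U>" "finite (\<phi> ` \<U>)"
      using UL WL G.finite_light_branches H.finite_light_branches finite_subset by blast+
    have finS: "\<And>S. S \<in> \<U> \<Longrightarrow> finite S" "\<And>S. S \<in> \<phi> ` \<U> \<Longrightarrow> finite S"
      using UL WL G.light_branchD(1) H.light_branchD(1) G.finite_branch H.finite_branch by blast+
    have lam: "laminar \<U>" "laminar (\<phi> ` \<U>)"
      using laminar_subset[OF G.laminar_light UL] laminar_subset[OF H.laminar_light WL] by auto
    have "family_iso (vertex_weights G) (vertex_weights H) \<phi> \<U> (\<phi> ` \<U>)"
      using family_iso_image[OF iso U] .
    then have isoU: "family_iso (wt G) (wt H) \<phi> \<U> (\<phi> ` \<U>)"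
      unfolding family_iso_def by (metis G.sum_vertex_weights H.sum_vertex_weights)
    have "wt H (part (\<phi> ` \<U>) (\<phi> S)) = wt G (part \<U> S)" if "S \<in> \<U>" for S
      using sum_part_family_iso[OF isoU fin finS lam that] .
    moreover have "mset_set (\<phi> ` \<U>) = image_mset \<phi> (mset_set \<U>)"
      using inj_on_subset[OF inj U] by (simp add: image_mset_mset_set)
    ultimately show ?thesis
      using fin(1) unfolding part_weights_def
      by (auto simp: image_mset.compositionality intro!: image_mset_cong)
  qed
  have "bij_betw ((`) \<phi>) (Pow \<A>) (Pow \<B>)" using bij by (rule bij_betw_Pow)
  then have P: "inj_on ((`) \<phi>) (Pow \<A>)" "(`) \<phi> ` Pow \<A> = Pow \<B>" by (auto simp: bij_betw_def)
  have "(`) \<phi> ` {\<U>. \<U> \<subseteq> \<A> \<and> part_weights G \<U> = M} = {\<W>. \<W> \<subseteq> \<B> \<and> part_weights H \<W> = M}"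
  proof
    show "(`) \<phi> ` {\<U>. \<U> \<subseteq> \<A> \<and> part_weights G \<U> = M} \<subseteq> {\<W>. \<W> \<subseteq> \<B> \<and> part_weights H \<W> = M}"
      using pw im by (intro image_subsetI) auto
    show "{\<W>. \<W> \<subseteq> \<B> \<and> part_weights H \<W> = M} \<subseteq> (`) \<phi> ` {\<U>. \<U> \<subseteq> \<A> \<and> part_weights G \<U> = M}"
    proof
      fix \<W> assume W: "\<W> \<in> {\<W>. \<W> \<subseteq> \<B> \<and> part_weights H \<W> = M}"
      then have "\<W> \<in> (`) \<phi> ` Pow \<A>" using P(2) by simp
      then obtain \<U> where "\<U> \<subseteq> \<A>" "\<W> = \<phi> ` \<U>" by blast
      then show "\<W> \<in> (`) \<phi> ` {\<U>. \<U> \<subseteq> \<A> \<and> part_weights G \<U> = M}" using W pw by auto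
    qed
  qed
  moreover have "card ((`) \<phi> ` {\<U>. \<U> \<subseteq> \<A> \<and> part_weights G \<U> = M}) =
      card {\<U>. \<U> \<subseteq> \<A> \<and> part_weights G \<U> = M}"
    by (intro card_image inj_on_subset[OF P(1)]) blast
  ultimately show ?thesis by simp
qed

text \<open>Downward closure makes the members below a branch coincide with all light branches below
  it, so a branch isomorphism matches them.\<close>

lemma ex_family_iso:
  assumes "tree G" "tree H" and tot: "total_weight G = total_weight H"
    and iso: "\<And>S R. S \<in> light_branches G \<Longrightarrow> R \<in> light_branches H \<Longrightarrow>
      vertex_weights G S = vertex_weights H R \<Longrightarrow> \<exists>f. branch_iso f G S H R"
    and A: "\<A> \<subseteq> light_branches G" "\<And>S Q. S \<in> \<A> \<Longrightarrow> Q \<in> light_branches G \<Longrightarrow> Q \<subseteq> S \<Longrightarrow> Q \<in> \<A>"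
    and B: "\<B> \<subseteq> light_branches H" "\<And>S Q. S \<in> \<B> \<Longrightarrow> Q \<in> light_branches H \<Longrightarrow> Q \<subseteq> S \<Longrightarrow> Q \<in> \<B>"
    and cnt: "\<And>x. card {S \<in> \<A>. vertex_weights G S = x} = card {S \<in> \<B>. vertex_weights H S = x}"
  shows "\<exists>\<phi>. family_iso (vertex_weights G) (vertex_weights H) \<phi> \<A> \<B>"
proof -
  interpret G: tree G by fact
  interpret H: tree H by fact
  show ?thesis
  proof (rule family_isoI[where c = size])
    show "finite \<A>" "finite \<B>"
      using A(1) B(1) G.finite_light_branches H.finite_light_branches finite_subset by blast+
    show "laminar \<A>" "laminar \<B>"
      using laminar_subset[OF G.laminar_light A(1)] laminar_subset[OF H.laminar_light B(1)] by auto
    show "finite S \<and> S \<noteq> {}" if "S \<in> \<A>" for S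
      using that A(1) G.light_branchD(1) G.finite_branch G.branch_nonempty by blast
    show "finite S \<and> S \<noteq> {}" if "S \<in> \<B>" for S
      using that B(1) H.light_branchD(1) H.finite_branch H.branch_nonempty by blast
    show "\<exists>\<phi>. family_iso (vertex_weights G) (vertex_weights H) \<phi> {Q \<in> \<A>. Q \<subseteq> S} {Q \<in> \<B>. Q \<subseteq> R}"
      if S: "S \<in> \<A>" and R: "R \<in> \<B>" and eq: "vertex_weights G S = vertex_weights H R" for S R
    proof -
      have SL: "S \<in> light_branches G" and RL: "R \<in> light_branches H" using S R A(1) B(1) by auto
      obtain f where f: "branch_iso f G S H R" using iso[OF SL RL eq] by blast
      have "{Q \<in> \<A>. Q \<subseteq> S} = {Q \<in> light_branches G. Q \<subseteq> S}" using A S by blast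
      moreover have "{Q \<in> \<B>. Q \<subseteq> R} = {Q \<in> light_branches H. Q \<subseteq> R}" using B R by blast
      ultimately show ?thesis using family_iso_below[OF assms(1-3) f SL RL] by auto
    qed
  qed (simp_all add: cnt)
qed

lemma card_light_branches_eq:
  assumes "tree G" "tree H" and W: "W_poly G = W_poly H"
    and iso: "\<And>S R. S \<in> light_branches G \<Longrightarrow> R \<in> light_branches H \<Longrightarrow>
      vertex_weights G S = vertex_weights H R \<Longrightarrow> \<exists>f. branch_iso f G S H R"
  shows "card {S \<in> light_branches G. vertex_weights G S = M} =
    card {S \<in> light_branches H. vertex_weights H S = M}"
\<comment> \<open>Among multisets of equal sum the larger ones have to be settled earlier; the
  difference \<open>sum_mset M - size M\<close> turns this downward direction into a
  measure.\<close>
proof (induction M rule: wf_induct_rule[OF wf_measures[of "[sum_mset, \<lambda>M. sum_mset M - size M]"]])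
  case (1 M)
  interpret G: tree G by fact
  interpret H: tree H by fact
  have tot: "total_weight G = total_weight H" using assms(1-3) by (rule W_poly_eq_imp_total_weight_eq)
  have wG: "wt G S = sum_mset x" "card S = size x" if "vertex_weights G S = x" for S x
    using that G.sum_vertex_weights[of S] by auto
  have wH: "wt H S = sum_mset x" "card S = size x" if "vertex_weights H S = x" for S x
    using that H.sum_vertex_weights[of S] by auto
  show ?case
  proof (cases "2 * sum_mset M \<le> total_weight G")
    case False
    then have "{S \<in> light_branches G. vertex_weights G S = M} = {}"
      "{S \<in> light_branches H. vertex_weights H S = M} = {}"
      using wG(1) wH(1) tot by (auto simp: light_branches_def)
    then show ?thesis by (simp only: card.empty)
  next
    case True
    define P where "P x = (sum_mset x < sum_mset M \<or> sum_mset x = sum_mset M \<and> size M < size x)" for x :: "nat multiset"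
    let ?A = "{S \<in> light_branches G. P (vertex_weights G S)}"
    let ?B = "{S \<in> light_branches H. P (vertex_weights H S)}"
    have PG: "P (vertex_weights G S) \<longleftrightarrow> wt G S < sum_mset M \<or> wt G S = sum_mset M \<and> size M < card S" for S
      unfolding P_def G.sum_vertex_weights by simp
    have PH: "P (vertex_weights H S) \<longleftrightarrow> wt H S < sum_mset M \<or> wt H S = sum_mset M \<and> size M < card S" for S
      unfolding P_def H.sum_vertex_weights by simp
    have cnt: "card {S \<in> ?A. vertex_weights G S = x} = card {S \<in> ?B. vertex_weights H S = x}" for x
    \<comment> \<open>The subtraction in the measure truncates when \<open>size x\<close> exceeds
      \<open>sum_mset x\<close>. Such a multiset is not attained by any branch, as weights are
      positive, so both sides are empty.\<close>
    proof (cases "P x \<and> size x \<le> sum_mset x")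
      case True
      then have "(x, M) \<in> measures [sum_mset, \<lambda>M. sum_mset M - size M]"
        unfolding P_def by auto
      then have "card {S \<in> light_branches G. vertex_weights G S = x} =
          card {S \<in> light_branches H. vertex_weights H S = x}" by (rule 1)
      moreover have "{S \<in> ?A. vertex_weights G S = x} = {S \<in> light_branches G. vertex_weights G S = x}"
        "{S \<in> ?B. vertex_weights H S = x} = {S \<in> light_branches H. vertex_weights H S = x}"
        using True by auto
      ultimately show ?thesis by simp
    next
      case False
      have "\<not> P x" if "S \<in> light_branches G" "vertex_weights G S = x" for S
        using G.card_le_wt[OF G.branch_subset[OF G.light_branchD(1)[OF that(1)]]] wG[OF that(2)] False
        by simp
      then have 1: "{S \<in> ?A. vertex_weights G S = x} = {}" by blast
      have "\<not> P x" if "S \<in> light_branches H" "vertex_weights H S = x" for S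
        using H.card_le_wt[OF H.branch_subset[OF H.light_branchD(1)[OF that(1)]]] wH[OF that(2)] False
        by simp
      then have 2: "{S \<in> ?B. vertex_weights H S = x} = {}" by blast
      show ?thesis unfolding 1 2 by simp
    qed
    have "\<exists>\<phi>. family_iso (vertex_weights G) (vertex_weights H) \<phi> ?A ?B"
    proof (rule ex_family_iso[OF assms(1,2) tot iso])
      show "Q \<in> ?A" if "S \<in> ?A" "Q \<in> light_branches G" "Q \<subseteq> S" for S Q
      proof (cases "Q = S")
        case False
        then have "wt G Q < wt G S"
          using that G.wt_strict_mono[of Q S] G.branch_subset G.light_branchD(1) by blast
        then show ?thesis using that by (auto simp: PG)
      qed (use that in simp)
      show "Q \<in> ?B" if "S \<in> ?B" "Q \<in> light_branches H" "Q \<subseteq> S" for S Q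
      proof (cases "Q = S")
        case False
        then have "wt H Q < wt H S"
          using that H.wt_strict_mono[of Q S] H.branch_subset H.light_branchD(1) by blast
        then show ?thesis using that by (auto simp: PH)
      qed (use that in simp)
    qed (use cnt in auto)
    then obtain \<phi> where \<phi>: "family_iso (vertex_weights G) (vertex_weights H) \<phi> ?A ?B" by blast
    have "card {\<U>. \<U> \<subseteq> ?A \<and> part_weights G \<U> = M} = card {\<W>. \<W> \<subseteq> ?B \<and> part_weights H \<W> = M}"
      by (rule card_families_family_iso[OF assms(1,2) \<phi>]) auto
    moreover have "card (branch_families G M) = card (branch_families H M)"
      using W_poly_eq_imp_card_branch_families_eq[OF assms(1-3) True] .
    ultimately show ?thesis
      using G.card_branch_families[OF True] H.card_branch_families[OF True[unfolded tot]]
      by (simp add: PG PH)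
  qed
qed

section \<open>Families with one light branch for each edge\<close>

context tree
begin

text \<open>Take a maximal member \<open>S\<close> and a member \<open>R\<close> containing the
  outer end \<open>p\<close> of its cut edge. By maximality and laminarity \<open>R\<close> misses
  the inner end, so the cut edge of \<open>S\<close> also leaves \<open>R\<close>. Then
  \<open>R\<close> is the complement of \<open>S\<close>, which is not in the family.\<close>

lemma covering_family:
  assumes N: "\<N> \<subseteq> light_branches G" and E: "cut_edge G ` \<N> = E"
    and compl: "\<And>S. S \<in> \<N> \<Longrightarrow> V - S \<notin> \<N>"
  shows "\<Union>\<N> \<noteq> V"
proof
  assume U: "\<Union>\<N> = V"
  have br: "branch G S" if "S \<in> \<N>" for S using that N light_branchD(1) by blast
  have fin: "finite \<N>" using br by (rule finite_branches)
  obtain S0 where "S0 \<in> \<N>" using U verts_nonempty by blast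
  then obtain S where S: "S \<in> \<N>" "\<And>R. R \<in> \<N> \<Longrightarrow> S \<subseteq> R \<Longrightarrow> S = R"
    using finite_has_maximal[OF fin] by blast
  obtain r p where rp: "cut_edge G S = {r, p}" "r \<in> S" "p \<in> V" "p \<notin> S"
    using br[OF S(1)] by (rule branchE)
  obtain R where R: "R \<in> \<N>" "p \<in> R" using rp(3) U by blast
  have "R \<noteq> S" using rp(4) R(2) by blast
  have "r \<notin> R"
  proof
    assume "r \<in> R"
    then have "S \<subseteq> R" using light_branches_laminar[of S R] N S(1) R rp by blast
    then show False using S(2)[OF R(1)] \<open>R \<noteq> S\<close> by blast
  qed
  moreover have "{p, r} \<in> E" using cut_edge_in[OF br[OF S(1)]] rp(1) by (simp add: insert_commute)
  ultimately have "cut_edge G R = {p, r}" using branch_crosses[OF br[OF R(1)]] R(2) by blast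
  then have "cut_edge G R = cut_edge G S" using rp(1) by (simp add: insert_commute)
  then have "R = V - S" using cut_edge_eq[OF br[OF R(1)] br[OF S(1)]] \<open>R \<noteq> S\<close> by blast
  then show False using compl[OF S(1)] R(1) by blast
qed

text \<open>If two complementary branches of half the total weight exist, one of them is dropped.\<close>

lemma covering_familyI:
  assumes X: "X = {} \<and> (\<forall>S\<in>light_branches G. 2 * wt G S \<noteq> total_weight G) \<or>
    (\<exists>S\<in>light_branches G. 2 * wt G S = total_weight G \<and> X = {S})"
  defines "\<N> \<equiv> light_branches G - X"
  shows "cut_edge G ` \<N> = E" and "\<Union>\<N> \<noteq> V"
proof -
  have compl_light: "V - S \<in> light_branches G"
    if "branch G S" "total_weight G \<le> 2 * wt G S" for S
    using that wt_Diff[OF branch_subset[OF that(1)]] branch_compl by (simp add: light_branches_def)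
  \<comment> \<open>At most one complementary pair has half weight: by laminarity \<open>S\<close>
    is comparable with \<open>R\<close> or contained in \<open>V - R\<close>, and all these sets
    have equal weight. Dropping one branch is therefore enough.\<close>
  have S_eq: "S = R \<or> S = V - R"
    if SR: "S \<in> light_branches G" "2 * wt G S = total_weight G"
      "R \<in> light_branches G" "2 * wt G R = total_weight G" for S R
  proof -
    have sub: "S \<subseteq> V" "R \<subseteq> V" using SR light_branchD(1) branch_subset by blast+
    consider "S \<subseteq> R" | "R \<subseteq> S" | "S \<subseteq> V - R"
      using light_branches_laminar[OF SR(1,3)] sub by blast
    then show ?thesis
    proof cases
      case 3
      have "wt G (V - R) = wt G S" using wt_Diff[OF sub(2)] SR by simp
      then show ?thesis using wt_strict_mono[of S "V - R"] 3 by (metis Diff_subset less_irrefl psubsetI)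
    qed (use wt_strict_mono[of S R] wt_strict_mono[of R S] sub SR in auto)
  qed
  show E: "cut_edge G ` \<N> = E"
  proof
    show "cut_edge G ` \<N> \<subseteq> E" using light_branchD(1) cut_edge_in by (auto simp: \<N>_def)
    show "E \<subseteq> cut_edge G ` \<N>"
    proof
      fix e assume e: "e \<in> E"
      obtain x where "x \<in> V" using verts_nonempty by blast
      then obtain S0 where S0: "branch G S0" "cut_edge G S0 = e" using branch_avoiding[OF e] by blast
      obtain S where S: "S \<in> light_branches G" "cut_edge G S = e"
      proof (cases "2 * wt G S0 \<le> total_weight G")
        case True
        then show thesis using that S0 by (auto simp: light_branches_def)
      next
        case False
        then show thesis using that[of "V - S0"] S0 compl_light cut_edge_compl by auto
      qed
      show "e \<in> cut_edge G ` \<N>"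
      proof (cases "S \<in> X")
        case True
        then have *: "2 * wt G S = total_weight G" "X = {S}" using X by auto
        have b: "branch G S" using S(1) by (rule light_branchD)
        have "V - S \<in> light_branches G" using compl_light[OF b] *(1) by simp
        moreover have "V - S \<noteq> S" using branch_nonempty[OF b] by blast
        ultimately have "V - S \<in> \<N>" using *(2) by (simp add: \<N>_def)
        then show ?thesis using S(2) cut_edge_compl by (metis imageI)
      next
        case False
        then show ?thesis using S by (auto simp: \<N>_def)
      qed
    qed
  qed
  have "V - S \<notin> \<N>" if S: "S \<in> \<N>" for S
  proof
    assume C: "V - S \<in> \<N>"
    have L: "S \<in> light_branches G" "V - S \<in> light_branches G" using S C by (auto simp: \<N>_def)
    have sub: "S \<subseteq> V" using L light_branchD(1) branch_subset by blast
    have h: "2 * wt G S = total_weight G"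
      using light_branchD(2)[OF L(1)] light_branchD(2)[OF L(2)] wt_Diff[OF sub] by simp
    then obtain T where T: "T \<in> light_branches G" "2 * wt G T = total_weight G" "X = {T}"
      using X L(1) by blast
    then show False using S_eq[OF T(1,2) L(1) h] S C by (auto simp: \<N>_def)
  qed
  then show "\<Union>\<N> \<noteq> V" using E by (intro covering_family) (auto simp: \<N>_def)
qed

end

section \<open>Reconstruction of the tree\<close>

definition covers :: "'a set set \<Rightarrow> 'a set \<Rightarrow> 'a set \<Rightarrow> bool" where
  "covers \<U> S R \<longleftrightarrow> S \<subset> R \<and> \<not> (\<exists>Q\<in>\<U>. S \<subset> Q \<and> Q \<subset> R)"

context tree
begin

context
  fixes \<N>
  assumes N: "\<N> \<subseteq> light_branches G" and cut: "cut_edge G ` \<N> = E" and ne: "\<Union>\<N> \<noteq> V"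
begin

lemma covering_branch: "S \<in> \<N> \<Longrightarrow> branch G S"
  using N light_branchD(1) by blast

text \<open>Adjoining \<open>V\<close> gives a top member whose part is the one vertex outside all
  branches, so that every vertex belongs to a member.\<close>

lemma laminar_covering: "laminar (insert V \<N>)"
  using laminar_subset[OF laminar_light N] covering_branch branch_subset
  unfolding laminar_def by blast

lemma covering_inj: "inj_on (cut_edge G) \<N>"
  by (rule inj_cut_edge[OF covering_branch ne])

lemma part_insert_verts: "S \<in> \<N> \<Longrightarrow> part (insert V \<N>) S = part \<N> S"
  using branch_subset[OF covering_branch] unfolding part_def by auto

lemma part_verts: "part (insert V \<N>) V = V - \<Union>\<N>"
  using branch_subset[OF covering_branch] branch_neq_verts[OF covering_branch] unfolding part_def by blast

text \<open>All edges are cut, so the components are the single vertices.\<close>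

lemma part_singleton:
  assumes "S \<in> insert V \<N>"
  shows "\<exists>x. part (insert V \<N>) S = {x}"
proof -
  have "insert (V - \<Union>\<N>) (part \<N> ` \<N>) = (\<lambda>v. {v}) ` V"
    using component_sets_branches(1)[OF covering_branch laminar_subset[OF laminar_light N] ne]
    unfolding cut by (simp add: component_sets_empty)
  moreover have "part (insert V \<N>) S \<in> insert (V - \<Union>\<N>) (part \<N> ` \<N>)"
    using assms part_insert_verts part_verts by auto
  ultimately show ?thesis by auto
qed

lemma Union_part_covering: "\<Union>(part (insert V \<N>) ` insert V \<N>) = V"
proof -
  have "finite (insert V \<N>)" using finite_branches[OF covering_branch] by simp
  then have "\<Union>(part (insert V \<N>) ` insert V \<N>) = \<Union>(insert V \<N>)" by (rule Union_part) auto
  then show ?thesis using branch_subset[OF covering_branch] by blast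
qed

text \<open>Apart from \<open>S\<close>, no member separates \<open>x\<close> from \<open>y\<close>.
  So \<open>R\<close>, which contains \<open>y\<close>, contains \<open>x\<close> and lies above
  \<open>S\<close>. A member strictly in between would contain \<open>x\<close>, hence
  \<open>y\<close>, although \<open>y\<close> is in the part of \<open>R\<close>.\<close>

lemma covers_of_cut_edge:
  assumes S: "S \<in> \<N>" "part (insert V \<N>) S = {x}" and R: "R \<in> insert V \<N>" "part (insert V \<N>) R = {y}"
    and e: "cut_edge G S = {x, y}" "x \<in> S" "y \<notin> S"
  shows "covers (insert V \<N>) S R"
proof -
  have y: "y \<notin> Q" if "Q \<in> \<N>" "Q \<subset> R" for Q
    using R(2) that unfolding part_def by blast
  have yR: "y \<in> R" using R(2) part_subset[of "insert V \<N>" R] by simp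
  have yx: "{y, x} \<in> E" using cut_edge_in[OF covering_branch[OF S(1)]] e(1) by (simp add: insert_commute)
  have through: "Q = S" if Q: "Q \<in> \<N>" "(x \<in> Q) \<noteq> (y \<in> Q)" for Q
  proof -
    have "{y, x} \<in> crossing G Q" using yx Q(2) by (auto simp: crossing_doubleton)
    then have "cut_edge G Q = cut_edge G S"
      using crossing_branch[OF covering_branch[OF Q(1)]] e(1) by (auto simp: insert_commute)
    then show ?thesis using covering_inj Q(1) S(1) by (auto dest: inj_onD)
  qed
  have "x \<in> R"
  proof (cases "R = V")
    case True
    then show ?thesis using e(2) branch_subset[OF covering_branch[OF S(1)]] by blast
  next
    case False
    then show ?thesis using through[of R] R(1) yR e(3) by blast
  qed
  then have "S \<subset> R"
    using laminarD[OF laminar_covering, of S R] S(1) R(1) e(2,3) yR by blast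
  moreover have False if "Q \<in> insert V \<N>" "S \<subset> Q" "Q \<subset> R" for Q
  proof -
    have "R \<subseteq> V" using R(1) branch_subset[OF covering_branch] by blast
    then have "Q \<in> \<N>" using that by blast
    then show False using through[of Q] y[of Q] that e(2) by blast
  qed
  ultimately show ?thesis unfolding covers_def by blast
qed

lemma covering_cut_edge:
  assumes "S \<in> \<N>" "part (insert V \<N>) S = {x}"
  shows "\<exists>y R. R \<in> insert V \<N> \<and> part (insert V \<N>) R = {y} \<and> cut_edge G S = {x, y} \<and>
    x \<in> S \<and> y \<notin> S"
proof -
  obtain r p where rp: "cut_edge G S = {r, p}" "r \<in> S" "p \<in> V" "p \<notin> S"
    using covering_branch[OF assms(1)] by (rule branchE)
  have "r \<in> part \<N> S" using root_in_part[OF covering_branch covering_inj assms(1) rp(1,2,4)] .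
  then have "r = x" using assms part_insert_verts by auto
  moreover have "p \<in> \<Union>(part (insert V \<N>) ` insert V \<N>)" using rp(3) unfolding Union_part_covering .
  then obtain R where R: "R \<in> insert V \<N>" "p \<in> part (insert V \<N>) R" by (rule UN_E)
  have "part (insert V \<N>) R = {p}" using part_singleton[OF R(1)] R(2) by auto
  ultimately show ?thesis using R(1) rp by blast
qed

text \<open>Every edge is the cut edge of a member, and parts identify the two members at its ends.
  Conversely, two members covering \<open>S\<close> both contain \<open>x\<close>, so they are
  comparable and hence equal: the member at the outer end of the cut edge of \<open>S\<close> is the
  only one covering \<open>S\<close>.\<close>

lemma edge_iff_covers:
  assumes S: "S \<in> insert V \<N>" "part (insert V \<N>) S = {x}"
    and R: "R \<in> insert V \<N>" "part (insert V \<N>) R = {y}"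
  shows "{x, y} \<in> E \<longleftrightarrow> covers (insert V \<N>) S R \<or> covers (insert V \<N>) R S"
proof
  assume e: "{x, y} \<in> E"
  then obtain Q where Q: "Q \<in> \<N>" "cut_edge G Q = {x, y}" using cut by (metis imageE)
  obtain z where z: "part (insert V \<N>) Q = {z}" using part_singleton Q(1) by blast
  obtain t T where t: "T \<in> insert V \<N>" "part (insert V \<N>) T = {t}" "cut_edge G Q = {z, t}"
      "z \<in> Q" "t \<notin> Q"
    using covering_cut_edge[OF Q(1) z] by blast
  have cov: "covers (insert V \<N>) Q T"
    by (rule covers_of_cut_edge[OF Q(1) z t])
  have same: "A = B"
    if "A \<in> insert V \<N>" "B \<in> insert V \<N>" "part (insert V \<N>) A = {a}" "part (insert V \<N>) B = {a}" for A B a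
    using part_disjoint[OF laminar_covering that(1,2)] that(3,4) by auto
  have "{x, y} = {z, t}" using Q(2) t(3) by simp
  then consider "x = z" "y = t" | "x = t" "y = z" by (auto simp: doubleton_eq_iff)
  then show "covers (insert V \<N>) S R \<or> covers (insert V \<N>) R S"
  proof cases
    case 1
    then have "Q = S" "T = R" using same z t S R Q(1) by blast+
    then show ?thesis using cov by simp
  next
    case 2
    then have "Q = R" "T = S" using same z t S R Q(1) by blast+
    then show ?thesis using cov by simp
  qed
next
  have *: "{x, y} \<in> E"
    if S: "S \<in> insert V \<N>" "part (insert V \<N>) S = {x}"
      and R: "R \<in> insert V \<N>" "part (insert V \<N>) R = {y}"
      and SR: "covers (insert V \<N>) S R" for S R x y
  proof -
    have "R \<subseteq> V" using R(1) branch_subset[OF covering_branch] by blast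
    then have SN: "S \<in> \<N>" using S(1) SR unfolding covers_def by blast
    obtain t T where t: "T \<in> insert V \<N>" "part (insert V \<N>) T = {t}" "cut_edge G S = {x, t}"
        "x \<in> S" "t \<notin> S"
      using covering_cut_edge[OF SN S(2)] by blast
    have cov: "covers (insert V \<N>) S T" by (rule covers_of_cut_edge[OF SN S(2) t])
    have "T \<subseteq> R \<or> R \<subseteq> T"
      using laminarD[OF laminar_covering t(1) R(1)] cov SR t(4) unfolding covers_def by blast
    then have "T = R" using cov SR t(1) R(1) unfolding covers_def by blast
    then show ?thesis using t(2,3) R(2) cut_edge_in[OF covering_branch[OF SN]] by simp
  qed
  assume "covers (insert V \<N>) S R \<or> covers (insert V \<N>) R S"
  then show "{x, y} \<in> E" using *[OF S R] *[OF R S] by (auto simp: insert_commute)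
qed

end

end

lemma isomorphic_of_family_iso:
  assumes "tree G" "tree H" and tot: "total_weight G = total_weight H"
    and N: "\<N> \<subseteq> light_branches G" "cut_edge G ` \<N> = edges G" "\<Union>\<N> \<noteq> verts G"
    and P: "\<P> \<subseteq> light_branches H" "cut_edge H ` \<P> = edges H" "\<Union>\<P> \<noteq> verts H"
    and iso: "family_iso (wt G) (wt H) \<phi> \<N> \<P>"
  shows "isomorphic G H"
proof -
  interpret G: tree G by fact
  interpret H: tree H by fact
  let ?N = "insert (verts G) \<N>" and ?P = "insert (verts H) \<P>"
  \<comment> \<open>Extension to the adjoined top members; equality of the total weights makes it
    preserve their labels as well.\<close>
  define \<psi> where "\<psi> S = (if S = verts G then verts H else \<phi> S)" for S
  have brN: "branch G S" if "S \<in> \<N>" for S using N(1) G.light_branchD(1) that by blast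
  have brP: "branch H S" if "S \<in> \<P>" for S using P(1) H.light_branchD(1) that by blast
  have subN: "S \<subseteq> verts G" "S \<noteq> verts G" if "S \<in> \<N>" for S
    using G.branch_subset G.branch_neq_verts brN that by blast+
  have subP: "S \<subseteq> verts H" "S \<noteq> verts H" if "S \<in> \<P>" for S
    using H.branch_subset H.branch_neq_verts brP that by blast+
  have bij: "bij_betw \<phi> \<N> \<P>" using iso by (simp add: family_iso_def)
  have \<phi>P: "\<phi> S \<in> \<P>" if "S \<in> \<N>" for S using bij that by (rule bij_betwE[rule_format])
  have \<psi>N: "\<psi> S = \<phi> S" if "S \<in> \<N>" for S using subN(2)[OF that] by (simp add: \<psi>_def)
  have \<psi>V: "\<psi> (verts G) = verts H" by (simp add: \<psi>_def)
  have "bij_betw \<psi> \<N> \<P> = bij_betw \<phi> \<N> \<P>" by (rule bij_betw_cong) (rule \<psi>N)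
  then have "bij_betw \<psi> \<N> \<P>" using bij by simp
  then have bij': "bij_betw \<psi> ?N ?P"
    using notIn_Un_bij_betw[of "verts G" \<N> \<psi> \<P>] subN(2) subP(2) \<psi>V by auto
  have ord: "R \<subseteq> S \<longleftrightarrow> \<psi> R \<subseteq> \<psi> S" if RS: "R \<in> ?N" "S \<in> ?N" for R S
  proof (cases "S = verts G")
    case True
    then have "R \<subseteq> S" using RS(1) subN(1) by blast
    moreover have "\<psi> R \<subseteq> verts H"
      using RS(1) subP(1)[OF \<phi>P, of R] \<psi>N[of R] \<psi>V by (elim insertE) simp_all
    ultimately show ?thesis using True \<psi>V by simp
  next
    case False
    then have S: "S \<in> \<N>" using RS(2) by blast
    show ?thesis
    proof (cases "R = verts G")
      case True
      have "\<not> verts G \<subseteq> S" using subN[OF S] by blast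
      moreover have "\<not> verts H \<subseteq> \<phi> S" using subP[OF \<phi>P[OF S]] by blast
      ultimately show ?thesis using True \<psi>V \<psi>N[OF S] by simp
    next
      case False
      then have R: "R \<in> \<N>" using RS(1) by blast
      then show ?thesis using iso S \<psi>N[OF S] \<psi>N[OF R] unfolding family_iso_def by simp
    qed
  qed
  have wt: "wt H (\<psi> S) = wt G S" if "S \<in> ?N" for S
  proof (cases "S = verts G")
    case True
    then show ?thesis using tot \<psi>V by (simp add: total_weight_def)
  next
    case False
    then have "S \<in> \<N>" using that by blast
    then show ?thesis using iso \<psi>N unfolding family_iso_def by simp
  qed
  have iso': "family_iso (wt G) (wt H) \<psi> ?N ?P"
    unfolding family_iso_def using bij' ord wt by blast
  note singG = G.part_singleton[OF N] and singH = H.part_singleton[OF P]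
  define x where "x S = the_elem (part ?N S)" for S
  define y where "y S = the_elem (part ?P S)" for S
  have x: "part ?N S = {x S}" if "S \<in> ?N" for S using singG[OF that] unfolding x_def by fastforce
  have y: "part ?P S = {y S}" if "S \<in> ?P" for S using singH[OF that] unfolding y_def by fastforce
  have imx: "x ` ?N = verts G"
  proof -
    have "part ?N ` ?N = (\<lambda>S. {x S}) ` ?N" using x by (rule image_cong[OF refl])
    then show ?thesis using G.Union_part_covering[OF N] by (simp only: UNION_singleton_eq_range)
  qed
  have imy: "y ` ?P = verts H"
  proof -
    have "part ?P ` ?P = (\<lambda>S. {y S}) ` ?P" using y by (rule image_cong[OF refl])
    then show ?thesis using H.Union_part_covering[OF P] by (simp only: UNION_singleton_eq_range)
  qed
  have injx: "inj_on x ?N"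
  proof (rule inj_onI)
    fix S R assume *: "S \<in> ?N" "R \<in> ?N" "x S = x R"
    then have "part ?N S \<inter> part ?N R \<noteq> {}" using x[OF *(1)] x[OF *(2)] by simp
    then show "S = R" using part_disjoint[OF G.laminar_covering[OF N] *(1,2)] by blast
  qed
  have injy: "inj_on y ?P"
  proof (rule inj_onI)
    fix S R assume *: "S \<in> ?P" "R \<in> ?P" "y S = y R"
    then have "part ?P S \<inter> part ?P R \<noteq> {}" using y[OF *(1)] y[OF *(2)] by simp
    then show "S = R" using part_disjoint[OF H.laminar_covering[OF P] *(1,2)] by blast
  qed
  have bx: "bij_betw x ?N (verts G)" and by': "bij_betw y ?P (verts H)"
    using imx imy injx injy by (auto simp: bij_betw_def)
  \<comment> \<open>A vertex is sent to the vertex of the member corresponding to its own. Adjacency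
    is transported as the covering relation, vertex weights as weights of parts.\<close>
  define f where "f = y \<circ> \<psi> \<circ> inv_into ?N x"
  have fx: "f (x S) = y (\<psi> S)" if "S \<in> ?N" for S
    using inv_into_f_f[OF injx that] by (simp add: f_def)
  have \<psi>P: "\<psi> S \<in> ?P" if "S \<in> ?N" for S using bij' that by (rule bij_betwE[rule_format])
  have bf: "bij_betw f (verts G) (verts H)"
    unfolding f_def
    using bij_betw_trans[OF bij_betw_inv_into[OF bx] bij_betw_trans[OF bij' by']] by (simp add: o_assoc)
  have strict: "R \<subset> S \<longleftrightarrow> \<psi> R \<subset> \<psi> S" if "R \<in> ?N" "S \<in> ?N" for R S
    using ord[OF that] ord[OF that(2,1)] by (simp add: less_le_not_le)
  have im\<psi>: "\<psi> ` ?N = ?P" using bij' by (simp add: bij_betw_def)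
  have cov: "covers ?N R S \<longleftrightarrow> covers ?P (\<psi> R) (\<psi> S)" if "R \<in> ?N" "S \<in> ?N" for R S
  proof -
    have "(\<exists>Q\<in>\<psi> ` ?N. \<psi> R \<subset> Q \<and> Q \<subset> \<psi> S) \<longleftrightarrow> (\<exists>Q\<in>?N. \<psi> R \<subset> \<psi> Q \<and> \<psi> Q \<subset> \<psi> S)"
      by (rule bex_simps(7))
    also have "\<dots> \<longleftrightarrow> (\<exists>Q\<in>?N. R \<subset> Q \<and> Q \<subset> S)"
    proof (rule bex_cong[OF refl])
      fix Q assume "Q \<in> ?N"
      then show "(\<psi> R \<subset> \<psi> Q \<and> \<psi> Q \<subset> \<psi> S) = (R \<subset> Q \<and> Q \<subset> S)"
        by (simp only: strict that)
    qed
    finally show ?thesis unfolding covers_def im\<psi> using strict[OF that] by (simp only: HOL.simp_thms)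
  qed
  have edge: "{u, v} \<in> edges G \<longleftrightarrow> {f u, f v} \<in> edges H" if uv: "u \<in> verts G" "v \<in> verts G" for u v
  proof -
    have "u \<in> x ` ?N" "v \<in> x ` ?N" using uv by (simp_all only: imx)
    then obtain S R where S: "S \<in> ?N" "u = x S" and R: "R \<in> ?N" "v = x R"
      by (elim imageE)
    have "{x S, x R} \<in> edges G \<longleftrightarrow> covers ?N S R \<or> covers ?N R S"
      by (rule G.edge_iff_covers[OF N S(1) x[OF S(1)] R(1) x[OF R(1)]])
    also have "\<dots> \<longleftrightarrow> covers ?P (\<psi> S) (\<psi> R) \<or> covers ?P (\<psi> R) (\<psi> S)"
      using cov S(1) R(1) by simp
    also have "\<dots> \<longleftrightarrow> {y (\<psi> S), y (\<psi> R)} \<in> edges H"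
      by (rule H.edge_iff_covers[OF P \<psi>P[OF S(1)] y[OF \<psi>P[OF S(1)]] \<psi>P[OF R(1)] y[OF \<psi>P[OF R(1)]], symmetric])
    finally show ?thesis using S R fx by simp
  qed
  have weight: "weight H (f u) = weight G u" if "u \<in> verts G" for u
  proof -
    have "u \<in> x ` ?N" using that by (simp only: imx)
    then obtain S where S: "S \<in> ?N" "u = x S" by (elim imageE)
    have "wt H (part ?P (\<psi> S)) = wt G (part ?N S)"
    proof (rule sum_part_family_iso[OF iso' _ _ _ _ G.laminar_covering[OF N] H.laminar_covering[OF P] S(1)])
      show "finite ?N" "finite ?P"
        using G.finite_branches[of \<N>] H.finite_branches[of \<P>] brN brP by simp_all
      show "finite S" if "S \<in> ?N" for S using that brN G.finite_branch G.finite_verts by blast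
      show "finite S" if "S \<in> ?P" for S using that brP H.finite_branch H.finite_verts by blast
    qed
    then show ?thesis using x[OF S(1)] y[OF \<psi>P[OF S(1)]] fx[OF S(1)] S(2) by simp
  qed
  show ?thesis unfolding isomorphic_def graph_iso_def using bf edge weight by blast
qed

section \<open>Light branches of good trees as shapes\<close>

context tree
begin

lemma leaf_of_branch:
  assumes "branch G S" "V - S = {v}"
  shows "is_leaf G v"
proof -
  obtain r p where rp: "cut_edge G S = {r, p}" "r \<in> S" "p \<in> V" "p \<notin> S"
    using assms(1) by (rule branchE)
  then have pv: "p = v" using assms(2) by blast
  have rV: "r \<in> V" using rp(2) branch_subset[OF assms(1)] by blast
  have "u = r" if "u \<in> V" "{u, v} \<in> E" for u
  proof -
    have "u \<noteq> v" using that(2) by (rule edge_neq)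
    then have "u \<in> S" using that(1) assms(2) by blast
    then have "cut_edge G S = {u, v}" using branch_crosses[OF assms(1) that(2)] rp(4) pv by blast
    then show ?thesis using rp(1) pv \<open>u \<noteq> v\<close> by (auto simp: doubleton_eq_iff)
  qed
  moreover have "{r, v} \<in> E" using cut_edge_in[OF assms(1)] rp(1) pv by simp
  ultimately have "neighbours G v = {r}" using rV unfolding neighbours_def by blast
  then show ?thesis using rp(3) pv by (simp add: is_leaf_def)
qed

text \<open>If only one vertex were left outside, it would be a leaf of weight 1. Then
  \<open>S\<close>, being at most as heavy as its complement, would have weight at most 1 in spite
  of its two vertices.\<close>

lemma light_branch_card:
  assumes leaf: "\<And>v. is_leaf G v \<Longrightarrow> weight G v = 1"
    and S: "S \<in> light_branches G" "2 \<le> card S"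
  shows "card S + 2 \<le> card V"
proof (rule ccontr)
  assume "\<not> card S + 2 \<le> card V"
  have b: "branch G S" using S(1) by (rule light_branchD)
  have SV: "S \<subset> V" using branch_subset[OF b] branch_neq_verts[OF b] by blast
  have "card (V - S) = card V - card S" using SV finite_branch[OF b] by (intro card_Diff_subset) auto
  moreover have "card S < card V" using SV finite_verts by (rule_tac psubset_card_mono)
  ultimately have "card (V - S) = 1" using \<open>\<not> card S + 2 \<le> card V\<close> by linarith
  then obtain v where v: "V - S = {v}" by (rule card_1_singletonE)
  then have "wt G (V - S) = 1" using leaf[OF leaf_of_branch[OF b v]] by simp
  then have "wt G S \<le> 1" using wt_Diff[of S] SV light_branchD(2)[OF S(1)] by auto
  then show False using card_le_wt[of S] SV S(2) by auto
qed

lemma branch_is_shape: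
  assumes b: "branch G S" and c: "2 \<le> card S" "card S + 2 \<le> card V"
    and r: "r \<in> cut_edge G S" "r \<in> S"
  shows "is_shape G (induced (delete_edge G (cut_edge G S)) S, r)"
proof -
  have "component_sets V (E - cut_edge G ` {S}) = insert (V - \<Union>{S}) (part {S} ` {S})"
    by (rule component_sets_branches) (use b branch_neq_verts[OF b] in \<open>auto simp: laminar_def\<close>)
  then have "S \<in> component_sets V (E - {cut_edge G S})" by (auto simp: part_def)
  then have "induced (delete_edge G (cut_edge G S)) S \<in> components (delete_edge G (cut_edge G S))"
    by (simp add: components_def delete_edge_def)
  then show ?thesis using c r cut_edge_in[OF b]
    unfolding is_shape_def by (auto simp: induced_def)
qed

end

lemma good_branch_iso:
  fixes \<T> :: "'a wgraph set"
  assumes good: "good \<T>" and "G \<in> \<T>" "H \<in> \<T>" and tot: "total_weight G = total_weight H"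
    and S: "S \<in> light_branches G" and R: "R \<in> light_branches H"
    and eq: "vertex_weights G S = vertex_weights H R"
  shows "\<exists>f. branch_iso f G S H R"
proof -
  have "weighted_tree G" "weighted_tree H" using good assms(2,3) by (auto simp: good_def)
  then interpret G: tree G + H: tree H by unfold_locales
  have leaf: "\<And>T v. T \<in> \<T> \<Longrightarrow> is_leaf T v \<Longrightarrow> weight T v = 1"
    using good unfolding good_def by (metis is_leaf_def)
  have bS: "branch G S" and bR: "branch H R" using S R G.light_branchD(1) H.light_branchD(1) by blast+
  have card: "card R = card S" using arg_cong[OF eq, of size] by simp
  obtain r p where rp: "cut_edge G S = {r, p}" "r \<in> S" "p \<in> verts G" "p \<notin> S" using bS by (rule G.branchE)
  obtain r' p' where rp': "cut_edge H R = {r', p'}" "r' \<in> R" "p' \<in> verts H" "p' \<notin> R" using bR by (rule H.branchE)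
  show ?thesis
  proof (cases "2 \<le> card S")
    \<comment> \<open>A single vertex is too small to be a shape, but here equality of the vertex
      weights already gives the isomorphism.\<close>
    case False
    moreover have "card S \<noteq> 0" using rp(2) G.finite_branch[OF bS] by auto
    ultimately have "card S = 1" by linarith
    then obtain x where "S = {x}" by (rule card_1_singletonE)
    then have "S = {r}" using rp(2) by auto
    moreover obtain y where "R = {y}" using card \<open>card S = 1\<close> by (metis card_1_singletonE)
    then have "R = {r'}" using rp'(2) by auto
    moreover have "{r, r} \<notin> edges G" "{r', r'} \<notin> edges H" using G.edge_neq H.edge_neq by blast+
    ultimately have "branch_iso (\<lambda>_. r') G S H R"
      using eq rp(1) rp'(1) by (simp add: branch_iso_def bij_betw_def)
    then show ?thesis by blast
  next
    case True
    let ?S = "induced (delete_edge G (cut_edge G S)) S" and ?R = "induced (delete_edge H (cut_edge H R)) R"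
    have shS: "is_shape G (?S, r)"
      using G.branch_is_shape[OF bS True G.light_branch_card[OF leaf[OF assms(2)] S True]] rp by simp
    have shR: "is_shape H (?R, r')"
      using H.branch_is_shape[OF bR _ H.light_branch_card[OF leaf[OF assms(3)] R]] rp' True card by simp
    have vw: "Ex_weights ?R = Ex_weights ?S" using eq by (simp add: Ex_weights_def induced_def delete_edge_def)
    have half: "real (total_weight ?R) \<le> real (total_weight H) / 2"
    proof -
      have "total_weight ?R = wt H R" by (simp add: total_weight_def induced_def delete_edge_def)
      then have "2 * total_weight ?R \<le> total_weight H" using H.light_branchD(2)[OF R] by simp
      then have "real (2 * total_weight ?R) \<le> real (total_weight H)" by (rule of_nat_mono)
      then show ?thesis by simp
    qed
    have "r_isomorphic (?S, r) (?R, r')"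
    proof -
      have "\<forall>T\<in>\<T>. \<forall>T'\<in>\<T>. \<forall>S S'.
        is_shape T S \<and> real (total_weight (fst S)) \<le> real (total_weight T) / 2 \<and>
        is_shape T' S' \<and> Ex_weights (fst S') = Ex_weights (fst S) \<longrightarrow> r_isomorphic S' S"
        using good unfolding good_def by (elim conjE)
      \<comment> \<open>The roles are exchanged, with the light shape taken from \<open>H\<close>,
        so that the resulting isomorphism goes from \<open>S\<close> to \<open>R\<close>.\<close>
      from this[rule_format, OF assms(3,2), of "(?R, r')" "(?S, r)"]
      show ?thesis using shS shR vw half by simp
    qed
    then obtain f where f: "graph_iso f ?S ?R" "f r = r'" by (auto simp: r_isomorphic_def)
    \<comment> \<open>The deleted cut edge has only one end in the branch, so deleting it changes no
      adjacency inside.\<close>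
    have inS: "{u, v} \<in> edges ?S \<longleftrightarrow> {u, v} \<in> edges G" if "u \<in> S" "v \<in> S" for u v
      using that rp by (auto simp: induced_def delete_edge_def doubleton_eq_iff)
    have inR: "{u, v} \<in> edges ?R \<longleftrightarrow> {u, v} \<in> edges H" if "u \<in> R" "v \<in> R" for u v
      using that rp' by (auto simp: induced_def delete_edge_def doubleton_eq_iff)
    have vS: "verts ?S = S" "verts ?R = R" "weight ?S = weight G" "weight ?R = weight H"
      by (simp_all add: induced_def delete_edge_def)
    have bij: "bij_betw f S R" using f(1) vS by (simp add: graph_iso_def)
    have fR: "f u \<in> R" if "u \<in> S" for u using bij that by (rule bij_betwE[rule_format])
    have "{u, v} \<in> edges G \<longleftrightarrow> {f u, f v} \<in> edges H" if "u \<in> S" "v \<in> S" for u v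
      using f(1) that inS[OF that] inR[OF fR[OF that(1)] fR[OF that(2)]] vS by (simp add: graph_iso_def)
    moreover have "weight H (f u) = weight G u" if "u \<in> S" for u
      using f(1) that vS by (simp add: graph_iso_def)
    moreover have "u \<in> cut_edge G S \<longleftrightarrow> f u \<in> cut_edge H R" if u: "u \<in> S" for u
    proof -
      have "u \<in> cut_edge G S \<longleftrightarrow> u = r" using rp u by auto
      moreover have "f u \<in> cut_edge H R \<longleftrightarrow> f u = r'" using rp' fR[OF u] by auto
      moreover have "f u = r' \<longleftrightarrow> u = r"
        using bij f(2) u rp(2) by (auto simp: bij_betw_def dest: inj_onD)
      ultimately show ?thesis by simp
    qed
    ultimately have "branch_iso f G S H R" using bij unfolding branch_iso_def by blast
    then show ?thesis by blast
  qed
qed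

theorem theorem1:
  fixes \<T> :: "'a wgraph set"
  assumes "good \<T>"
    and "T \<in> \<T>" and "T' \<in> \<T>"
    and "W_poly T = W_poly T'"
  shows "isomorphic T T'"
proof -
  have "weighted_tree T" "weighted_tree T'" using assms(1-3) by (auto simp: good_def)
  then have trees: "tree T" "tree T'" by unfold_locales
  interpret T: tree T by fact
  interpret T': tree T' by fact
  have tot: "total_weight T = total_weight T'"
    using trees assms(4) by (rule W_poly_eq_imp_total_weight_eq)
  note iso = good_branch_iso[OF assms(1-3) tot]
  have "\<exists>\<phi>. family_iso (vertex_weights T) (vertex_weights T') \<phi> (light_branches T) (light_branches T')"
  proof (rule ex_family_iso[OF trees tot])
    show "card {S \<in> light_branches T. vertex_weights T S = M} =
        card {S \<in> light_branches T'. vertex_weights T' S = M}" for M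
      by (rule card_light_branches_eq[OF trees assms(4)]) (rule iso)
  qed (simp_all add: iso)
  then obtain \<phi> where \<phi>: "family_iso (vertex_weights T) (vertex_weights T') \<phi> (light_branches T) (light_branches T')"
    by blast
  have bij: "bij_betw \<phi> (light_branches T) (light_branches T')" using \<phi> by (simp add: family_iso_def)
  then have inj: "inj_on \<phi> (light_branches T)" and im: "\<phi> ` light_branches T = light_branches T'"
    by (auto simp: bij_betw_def)
  have wt: "wt T' (\<phi> S) = wt T S" if "S \<in> light_branches T" for S
  proof -
    have "vertex_weights T' (\<phi> S) = vertex_weights T S" using \<phi> that by (simp add: family_iso_def)
    then show ?thesis by (metis T.sum_vertex_weights T'.sum_vertex_weights)
  qed
  \<comment> \<open>One branch of a halving pair, if there is such a pair. In \<open>T'\<close> its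
    image under \<open>\<phi>\<close> is dropped instead of an independent choice, so that
    \<open>\<phi>\<close> restricts to the remaining families.\<close>
  define X where "X = (if \<exists>S\<in>light_branches T. 2 * wt T S = total_weight T
    then {SOME S. S \<in> light_branches T \<and> 2 * wt T S = total_weight T} else {})"
  have X: "X = {} \<and> (\<forall>S\<in>light_branches T. 2 * wt T S \<noteq> total_weight T) \<or>
    (\<exists>S\<in>light_branches T. 2 * wt T S = total_weight T \<and> X = {S})"
  proof (cases "\<exists>S. S \<in> light_branches T \<and> 2 * wt T S = total_weight T")
    case True
    from someI_ex[OF this] show ?thesis using True by (auto simp: X_def)
  next
    case False
    then show ?thesis by (auto simp: X_def)
  qed
  then have X': "\<phi> ` X = {} \<and> (\<forall>S\<in>light_branches T'. 2 * wt T' S \<noteq> total_weight T') \<or>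
    (\<exists>S\<in>light_branches T'. 2 * wt T' S = total_weight T' \<and> \<phi> ` X = {S})"
    using wt tot unfolding im[symmetric] by auto
  have "X \<subseteq> light_branches T" using X by blast
  then have "\<phi> ` (light_branches T - X) = light_branches T' - \<phi> ` X"
    using inj_on_image_set_diff[OF inj] im by auto
  then have iso: "family_iso (vertex_weights T) (vertex_weights T') \<phi>
      (light_branches T - X) (light_branches T' - \<phi> ` X)"
    using family_iso_image[OF \<phi>, of "light_branches T - X"] by auto
  have "family_iso (wt T) (wt T') \<phi> (light_branches T - X) (light_branches T' - \<phi> ` X)"
    using iso wt unfolding family_iso_def by simp
  then show ?thesis
    by (intro isomorphic_of_family_iso[OF trees tot _ T.covering_familyI[OF X] _ T'.covering_familyI[OF X']]) auto
qed

end
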